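(* Let $\mathcal{H}$ be a separable, infinite-dimensional, complex Hilbert space, let $C$ be a conjugation on $\mathcal{H}$, and let $\mathcal{L}\subset\mathcal{O}_C$. Then $\mathcal{L}$ is a Lie ideal of $\mathcal{O}_C$ if and only if there exists an associative ideal $\mathcal{I}$ of $\mathcal{B}(\mathcal{H})$ such that $\mathcal{L}=\mathcal{I}\cap\mathcal{O}_C$.
   Context: $\mathcal{B}(\mathcal{H})$ is the algebra of all bounded linear operators on $\mathcal{H}$. A conjugation on $\mathcal{H}$ is a conjugate-linear map $C:\mathcal{H}\to\mathcal{H}$ that is invertible with $C^{-1}=C$ and satisfies $\langle Cx,Cy\rangle=\langle y,x\rangle$ for all $x,y\in\mathcal{H}$. $\mathcal{O}_C=\{X\in\mathcal{B}(\mathcal{H}): CXC=-X^*\}$, which is a Lie algebra under $[X,Y]=XY-YX$. A Lie ideal of $\mathcal{O}_C$ is a linear manifold (linear subspace, not assumed closed in any topology) $\mathcal{L}\subset\mathcal{O}_C$ such that $[A,X]\in\mathcal{L}$ for every $A\in\mathcal{O}_C$ and $X\in\mathcal{L}$. An associative ideal of $\mathcal{B}(\mathcal{H})$ is a two-sided ideal of $\mathcal{B}(\mathcal{H})$ under the usual multiplication of operators (not assumed closed). *)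

theory Defs
  imports "HOL-Analysis.Analysis" "HOL-Algebra.Ideal"
begin

class complex_vector = real_vector +
  fixes scaleC :: "complex \<Rightarrow> 'a \<Rightarrow> 'a"  (infixr "*\<^sub>C" 75)
  assumes scaleC_add_right: "a *\<^sub>C (x + y) = a *\<^sub>C x + a *\<^sub>C y"
    and scaleC_add_left: "(a + b) *\<^sub>C x = a *\<^sub>C x + b *\<^sub>C x"
    and scaleC_scaleC: "a *\<^sub>C (b *\<^sub>C x) = (a * b) *\<^sub>C x"
    and scaleC_one: "1 *\<^sub>C x = x"
    and scaleR_scaleC: "r *\<^sub>R x = complex_of_real r *\<^sub>C x"

global_interpretation complex_vector:
  vector_space "scaleC :: complex \<Rightarrow> 'a \<Rightarrow> 'a::complex_vector"
  by standard (simp_all add: scaleC_add_right scaleC_add_left scaleC_scaleC scaleC_one)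

text \<open>The real inner product of the superclass is the real part of the complex one, so the
  norm and the topology are those of the complex inner product; \<open>cinner\<close> is linear
  in its first argument.\<close>

class complex_inner = real_inner + complex_vector +
  fixes cinner :: "'a \<Rightarrow> 'a \<Rightarrow> complex"
  assumes cinner_commute: "cinner x y = cnj (cinner y x)"
    and cinner_add_left: "cinner (x + y) z = cinner x z + cinner y z"
    and cinner_scaleC_left: "cinner (a *\<^sub>C x) y = a * cinner x y"
    and inner_eq_Re_cinner: "inner x y = Re (cinner x y)"

class complex_hilbert_space = complex_inner + complete_space

lemma cinner_scaleC_right:
  fixes x y :: "'a::complex_inner"
  shows "cinner x (a *\<^sub>C y) = cnj a * cinner x y"
  by (metis cinner_commute cinner_scaleC_left complex_cnj_mult)

lemma cinner_add_right:
  fixes x y z :: "'a::complex_inner"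
  shows "cinner x (y + z) = cinner x y + cinner x z"
  by (metis cinner_commute cinner_add_left complex_cnj_add)

lemma norm_scaleC:
  fixes x :: "'a::complex_inner"
  shows "norm (a *\<^sub>C x) = cmod a * norm x"
proof -
  have "inner (a *\<^sub>C x) (a *\<^sub>C x) = Re (a * cnj a * cinner x x)"
    by (simp only: inner_eq_Re_cinner cinner_scaleC_left cinner_scaleC_right mult.assoc mult.left_commute)
  also have "a * cnj a = complex_of_real ((cmod a)\<^sup>2)"
    by (rule complex_norm_square [symmetric])
  also have "Re (\<dots> * cinner x x) = (cmod a)\<^sup>2 * inner x x"
    by (simp add: inner_eq_Re_cinner)
  finally show ?thesis
    by (simp add: norm_eq_sqrt_inner real_sqrt_mult)
qed

lemma bounded_linear_scaleC:
  "bounded_linear (scaleC a :: 'a::complex_inner \<Rightarrow> 'a)"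
proof (rule bounded_linear_intro)
  fix x y :: 'a and r :: real
  show "a *\<^sub>C (x + y) = a *\<^sub>C x + a *\<^sub>C y"
    by (rule scaleC_add_right)
  show "a *\<^sub>C (r *\<^sub>R x) = r *\<^sub>R (a *\<^sub>C x)"
    by (simp add: scaleR_scaleC scaleC_scaleC mult.commute)
  show "norm (a *\<^sub>C x) \<le> norm x * cmod a"
    by (simp add: norm_scaleC mult.commute)
qed

instantiation blinfun :: (real_normed_vector, complex_inner) complex_vector
begin

lift_definition scaleC_blinfun :: "complex \<Rightarrow> ('a \<Rightarrow>\<^sub>L 'b) \<Rightarrow> ('a \<Rightarrow>\<^sub>L 'b)"
  is "\<lambda>a f x. a *\<^sub>C f x"
  by (rule bounded_linear_compose [OF bounded_linear_scaleC])

instance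
  by standard
    (transfer, simp add: fun_eq_iff scaleC_add_right scaleC_add_left scaleC_scaleC scaleC_one
      scaleR_scaleC)+

end

definition infinite_dimensional :: "'a::complex_vector itself \<Rightarrow> bool" where
  "infinite_dimensional _ \<longleftrightarrow>
     \<not> (\<exists>B :: 'a set. finite B \<and> complex_vector.span B = UNIV)"

text \<open>The type \<open>'a \<Rightarrow>\<^sub>L 'a\<close> consists of the bounded \<^emph>\<open>real\<close>-linear maps; the algebra
  of bounded operators is carved out of it by complex homogeneity.\<close>

definition bounded_ops :: "('a::complex_inner \<Rightarrow>\<^sub>L 'a) set" where
  "bounded_ops = {X :: 'a \<Rightarrow>\<^sub>L 'a. \<forall>a x. X (a *\<^sub>C x) = a *\<^sub>C X x}"

definition bounded_ops_ring :: "('a::complex_inner \<Rightarrow>\<^sub>L 'a) ring" where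
  "bounded_ops_ring = \<lparr>carrier = bounded_ops, mult = (o\<^sub>L), one = id_blinfun,
     zero = 0, add = (+)\<rparr>"

lemma ring_bounded_ops_ring: "ring (bounded_ops_ring :: ('a::complex_inner \<Rightarrow>\<^sub>L 'a) ring)"
proof (rule ringI)
  have uminus: "- X \<in> bounded_ops" if "X \<in> bounded_ops" for X :: "'a \<Rightarrow>\<^sub>L 'a"
    using that
    by (simp add: bounded_ops_def blinfun.minus_left)
  show "abelian_group (bounded_ops_ring :: ('a \<Rightarrow>\<^sub>L 'a) ring)"
  proof (rule abelian_groupI)
    fix X :: "'a \<Rightarrow>\<^sub>L 'a"
    assume "X \<in> carrier bounded_ops_ring"
    then show "\<exists>Y\<in>carrier bounded_ops_ring.
        Y \<oplus>\<^bsub>bounded_ops_ring\<^esub> X = \<zero>\<^bsub>bounded_ops_ring\<^esub>"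
      using uminus [of X] by (auto simp: bounded_ops_ring_def intro!: bexI [of _ "- X"])
  qed (auto simp: bounded_ops_ring_def bounded_ops_def blinfun.add_left scaleC_add_right add_ac)
  show "Group.monoid (bounded_ops_ring :: ('a \<Rightarrow>\<^sub>L 'a) ring)"
    by (rule monoidI)
      (auto simp: bounded_ops_ring_def bounded_ops_def intro: blinfun_eqI)
qed (auto simp: bounded_ops_ring_def intro!: blinfun_eqI simp: blinfun.add_left blinfun.add_right)

text \<open>On a Hilbert space \<open>adjoint_op X\<close> is the adjoint of every \<open>X \<in> bounded_ops\<close>
  (existence by the Riesz representation theorem); for a map that is only real-linear the
  description may be void, and \<open>adjoint_op\<close> is not used there.\<close>

definition adjoint_op :: "('a::complex_inner \<Rightarrow>\<^sub>L 'a) \<Rightarrow> ('a \<Rightarrow>\<^sub>L 'a)" where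
  "adjoint_op X = (THE Y :: 'a \<Rightarrow>\<^sub>L 'a. \<forall>x y. cinner (X x) y = cinner x (Y y))"

lemma adjoint_op_eqI:
  fixes X Y :: "'a::complex_inner \<Rightarrow>\<^sub>L 'a"
  assumes "\<And>x y. cinner (X x) y = cinner x (Y y)"
  shows "adjoint_op X = Y"
  unfolding adjoint_op_def
proof (rule the_equality)
  fix Z :: "'a \<Rightarrow>\<^sub>L 'a"
  assume Z: "\<forall>x y. cinner (X x) y = cinner x (Z y)"
  show "Z = Y"
  proof (rule blinfun_eqI)
    fix y
    have "inner x (Z y) = inner x (Y y)" for x
      using Z assms by (metis inner_eq_Re_cinner)
    then show "Z y = Y y"
      by (metis vector_eq_ldot)
  qed
qed (use assms in blast)

text \<open>HOL-Algebra redefines the \<open>inv\<close> syntax, so the inverse function is written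
  \<open>inv_into UNIV\<close>.\<close>

definition conjugation :: "('a::complex_inner \<Rightarrow> 'a) \<Rightarrow> bool" where
  "conjugation C \<longleftrightarrow>
     (\<forall>x y. C (x + y) = C x + C y) \<and>
     (\<forall>a x. C (a *\<^sub>C x) = cnj a *\<^sub>C C x) \<and>
     bij C \<and> inv_into UNIV C = C \<and>
     (\<forall>x y. cinner (C x) (C y) = cinner y x)"

definition skew_ops :: "('a::complex_inner \<Rightarrow> 'a) \<Rightarrow> ('a \<Rightarrow>\<^sub>L 'a) set" where
  "skew_ops C = {X \<in> bounded_ops. \<forall>x. C (X (C x)) = - (adjoint_op X x)}"

definition commutator :: "('a::real_normed_vector \<Rightarrow>\<^sub>L 'a) \<Rightarrow> ('a \<Rightarrow>\<^sub>L 'a) \<Rightarrow> ('a \<Rightarrow>\<^sub>L 'a)" where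
  "commutator X Y = (X o\<^sub>L Y) - (Y o\<^sub>L X)"

definition lie_ideal :: "('a::complex_inner \<Rightarrow>\<^sub>L 'a) set \<Rightarrow> ('a \<Rightarrow>\<^sub>L 'a) set \<Rightarrow> bool" where
  "lie_ideal L \<O> \<longleftrightarrow>
     L \<subseteq> \<O> \<and> complex_vector.subspace L \<and>
     (\<forall>A\<in>\<O>. \<forall>X\<in>L. commutator A X \<in> L)"

end

theory Submission
  imports Defs
begin

text \<open>
  Write \<open>X\<^sup>t = C X\<^sup>* C\<close>, so that \<open>\<O>\<^sub>C\<close> consists of the \<open>X\<close> with \<open>X\<^sup>t = - X\<close>. A real
  orthonormal basis (one fixed by \<open>C\<close>) splits the space into three copies of itself, and thereby
  \<open>\<O>\<^sub>C\<close> becomes the skew elements of the \<open>3 \<times> 3\<close> matrices over \<open>R = B(H)\<close>. For a Lie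
  ideal \<open>L\<close>, the \<open>s\<close> for which \<open>L\<close> contains the skew matrix with \<open>s\<close> in a given
  off-diagonal position form an ideal \<open>N\<close> of \<open>R\<close> not depending on the position, and
  the matrices with entries in \<open>N\<close> form the required associative ideal.

  Brackets of \<open>X \<in> L\<close> show that its off-diagonal entries lie in \<open>N\<close> and that its diagonal
  entries are central modulo \<open>N\<close>. To get the diagonal entries themselves into \<open>N\<close>, and
  conversely diagonal matrices over \<open>N\<close> into \<open>L\<close>, one uses that a skew \<open>y\<close> which commutes
  with \<open>C\<close> is off-diagonal with respect to some orthogonal projection \<open>p = p\<^sup>t\<close>: real vectors
  \<open>x\<close> satisfy \<open>x \<bottom> y\<^sup>2\<^sup>k\<^sup>+\<^sup>1 x\<close>, so one may project onto a maximal set of real vectors that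
  satisfy this relation pairwise. A general skew \<open>y\<close> has a real and an imaginary part and needs
  two projections.
\<close>

section \<open>Lie ideals of the skew elements of a ring with involution\<close>

text \<open>\<open>p x (1 - p) + (1 - p) x p\<close> multiplied out, so that no unit is needed.\<close>

definition off :: "'r::ring \<Rightarrow> 'r \<Rightarrow> 'r" where
  "off p x = p * x + x * p - (p * x * p + p * x * p)"

text \<open>\<open>w\<^sub>1\<close> and \<open>w\<^sub>2\<close> model isometries with
  complementary ranges, so the ring looks like the \<open>2 \<times> 2\<close> matrices over itself,
  with \<open>t\<close> as transposition. \<open>splitting\<close> records that a skew element is
  exhausted by two successive off-diagonal parts.\<close>

locale split_involution =
  fixes t :: "'r::{ring,monoid_mult} \<Rightarrow> 'r" and w\<^sub>1 w\<^sub>2 :: 'r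
  assumes t_add: "t (x + y) = t x + t y"
    and t_mult: "t (x * y) = t y * t x"
    and t_t [simp]: "t (t x) = x"
    and w_11: "t w\<^sub>1 * w\<^sub>1 = 1" and w_22: "t w\<^sub>2 * w\<^sub>2 = 1"
    and w_12: "t w\<^sub>1 * w\<^sub>2 = 0"
    and w_sum: "w\<^sub>1 * t w\<^sub>1 + w\<^sub>2 * t w\<^sub>2 = 1"
    and splitting: "t x = - x \<Longrightarrow>
      \<exists>p q. t p = p \<and> p * p = p \<and> t q = q \<and> q * q = q \<and> x = off p x + off q (x - off p x)"
begin

lemma t_0 [simp]: "t 0 = 0"
  using t_add[of 0 0] by simp

lemma t_minus: "t (- x) = - t x"
  using t_add[of x "- x"] by (simp add: eq_neg_iff_add_eq_0 add.commute)

lemma t_diff: "t (x - y) = t x - t y"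
  using t_add[of x "- y"] by (simp add: t_minus)

lemmas t_simps = t_add t_mult t_minus t_diff

lemma w_21: "t w\<^sub>2 * w\<^sub>1 = 0"
  by (metis t_0 t_mult t_t w_12)

text \<open>The range of \<open>w\<^sub>2\<close> is split once more, which gives three isometries
  with complementary ranges; \<open>t (v i) * x * v k\<close> is the \<open>(i, k)\<close> entry of
  \<open>x\<close> as a \<open>3 \<times> 3\<close> matrix. The third index is what allows a bracket
  of two \<open>F\<close> matrices to be another one.\<close>

definition v :: "nat \<Rightarrow> 'r" where
  "v i = (if i = 0 then w\<^sub>1 else if i = 1 then w\<^sub>2 * w\<^sub>1 else w\<^sub>2 * w\<^sub>2)"

lemma mult_left_eq: "a * b = c \<Longrightarrow> a * (b * x) = c * x" for a b c x :: 'r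
  by (simp add: mult.assoc[symmetric])

lemma v_v: "i < 3 \<Longrightarrow> k < 3 \<Longrightarrow> t (v i) * v k = (if i = k then 1 else 0)"
  by (auto simp: v_def t_mult mult.assoc w_11 w_22 w_12 w_21
      mult_left_eq[OF w_11] mult_left_eq[OF w_22] mult_left_eq[OF w_12] mult_left_eq[OF w_21])

lemma v_v_left: "i < 3 \<Longrightarrow> k < 3 \<Longrightarrow> t (v i) * (v k * x) = (if i = k then x else 0)"
  using mult_left_eq[OF v_v] by (auto split: if_splits)

lemma v_sum: "(\<Sum>i<3. v i * t (v i)) = 1"
proof -
  have "(\<Sum>i<3. v i * t (v i)) = w\<^sub>1 * t w\<^sub>1 + w\<^sub>2 * (w\<^sub>1 * t w\<^sub>1 + w\<^sub>2 * t w\<^sub>2) * t w\<^sub>2"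
    by (simp add: v_def t_mult algebra_simps eval_nat_numeral)
  then show ?thesis
    by (simp add: w_sum)
qed

text \<open>For \<open>i \<noteq> k\<close>, the skew matrix with \<open>s\<close> at
  \<open>(i, k)\<close> and \<open>- t s\<close> at \<open>(k, i)\<close>; \<open>D\<close> below
  has the single entry \<open>y\<close> at \<open>(i, i)\<close>.\<close>

definition F :: "nat \<Rightarrow> nat \<Rightarrow> 'r \<Rightarrow> 'r" where
  "F i k s = v i * s * t (v k) - v k * t s * t (v i)"

definition D :: "nat \<Rightarrow> 'r \<Rightarrow> 'r" where
  "D i y = v i * y * t (v i)"

lemma t_F: "t (F i k s) = - F i k s"
  by (simp add: F_def t_simps mult.assoc)

lemma t_D: "t y = - y \<Longrightarrow> t (D i y) = - D i y"
  by (simp add: D_def t_simps mult.assoc)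

lemma F_add: "F i k (s + u) = F i k s + F i k u"
  by (simp add: F_def t_simps algebra_simps)

lemma F_minus: "F i k (- s) = - F i k s"
  by (simp add: F_def t_simps algebra_simps)

text \<open>As for matrix units, only products through the shared index \<open>k\<close> survive;
  the one in the opposite order supplies the mirror entry demanded by skewness.\<close>

lemma bracket_F_F:
  assumes "i < 3" "k < 3" "l < 3" "i \<noteq> k" "k \<noteq> l" "i \<noteq> l"
  shows "F i k s * F k l u - F k l u * F i k s = F i l (s * u)"
  using assms by (simp add: F_def t_mult algebra_simps v_v v_v_left)

text \<open>With both indices shared the surviving products lie on the diagonal; this is how
  diagonal matrices get into a Lie ideal.\<close>

lemma bracket_F_F_same:
  assumes "i < 3" "k < 3" "i \<noteq> k"
  shows "F i k s * F i k u - F i k u * F i k s =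
    D i (u * t s - s * t u) + D k (t u * s - t s * u)"
  using assms by (simp add: F_def D_def t_mult algebra_simps v_v v_v_left)

lemma t_off: "t p = p \<Longrightarrow> t x = - x \<Longrightarrow> t (off p x) = - off p x"
  by (simp add: off_def t_simps algebra_simps)

text \<open>A right-angle rotation between the two halves: a skew square root of \<open>- 1\<close>.
  It stands in for the unit in diagonal matrices, since \<open>D i J\<close> is skew and
  \<open>J\<close> can be cancelled.\<close>

definition J :: 'r where "J = w\<^sub>1 * t w\<^sub>2 - w\<^sub>2 * t w\<^sub>1"

lemma t_J: "t J = - J"
  by (simp add: J_def t_simps)

lemma J_J: "J * J = - 1"
proof -
  have "J * J = - (w\<^sub>1 * t w\<^sub>1 + w\<^sub>2 * t w\<^sub>2)"
    by (simp add: J_def algebra_simps w_12 w_21 w_11 w_22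
      mult_left_eq[OF w_11] mult_left_eq[OF w_22] mult_left_eq[OF w_12] mult_left_eq[OF w_21])
  then show ?thesis by (simp add: w_sum)
qed

end

section \<open>The ideal of off-diagonal entries of a Lie ideal\<close>

locale lie_ideal_of_skew = split_involution t w\<^sub>1 w\<^sub>2
  for t :: "'r::{ring,monoid_mult} \<Rightarrow> 'r" and w\<^sub>1 w\<^sub>2 +
  fixes L :: "'r set"
  assumes L_0: "0 \<in> L"
    and L_add: "x \<in> L \<Longrightarrow> y \<in> L \<Longrightarrow> x + y \<in> L"
    and L_minus: "x \<in> L \<Longrightarrow> - x \<in> L"
    and L_skew: "x \<in> L \<Longrightarrow> t x = - x"
    and L_bracket: "t a = - a \<Longrightarrow> x \<in> L \<Longrightarrow> a * x - x * a \<in> L"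
begin

lemma L_bracket': "t a = - a \<Longrightarrow> x \<in> L \<Longrightarrow> x * a - a * x \<in> L"
  using L_minus[OF L_bracket] by fastforce

text \<open>Bracketing with \<open>F k l u\<close> multiplies the entry by \<open>u\<close> and
  moves it along its row; \<open>F_left\<close> does the same along a column.\<close>

lemma F_right:
  assumes "i < 3" "k < 3" "l < 3" "i \<noteq> k" "k \<noteq> l" "i \<noteq> l" "F i k s \<in> L"
  shows "F i l (s * u) \<in> L"
  using L_bracket'[OF t_F assms(7)] bracket_F_F[OF assms(1-6)] by metis

lemma F_left:
  assumes "i < 3" "k < 3" "l < 3" "i \<noteq> k" "k \<noteq> l" "i \<noteq> l" "F k l s \<in> L"
  shows "F i l (u * s) \<in> L"
  using L_bracket[OF t_F assms(7)] bracket_F_F[OF assms(1-6)] by metis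

definition N :: "'r set" where "N = {s. F 0 1 s \<in> L}"

lemma F_any:
  assumes "i < 3" "k < 3" "i \<noteq> k" "F i k s \<in> L" "i' < 3" "k' < 3" "i' \<noteq> k'"
  shows "F i' k' s \<in> L"
proof -
  \<comment> \<open>Taking \<open>u = 1\<close> moves an unchanged entry: \<open>R\<close> keeps its
    row, \<open>L\<close> keeps its column. Chains of such moves link any two off-diagonal
    positions.\<close>
  have R: "F i l s \<in> L" if "F i k s \<in> L" "i < 3" "k < 3" "l < 3" "i \<noteq> k" "k \<noteq> l" "i \<noteq> l" for i k l
    using F_right[of i k l s 1] that by simp
  have L: "F l k s \<in> L" if "F i k s \<in> L" "i < 3" "k < 3" "l < 3" "i \<noteq> k" "k \<noteq> l" "i \<noteq> l" for i k l
    using F_left[of l i k s 1] that by simp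
  have three: "i = 0 \<or> i = 1 \<or> i = 2" if "i < 3" for i :: nat
    using that by auto
  have "F 0 1 s \<in> L"
    using three[OF assms(1)] three[OF assms(2)] assms(3,4)
      R[of 0 2 1] L[of 2 1 0] R[of 2 0 1] L[of 1 0 2] R[of 1 2 0]
    by auto
  then show ?thesis
    using three[OF assms(5)] three[OF assms(6)] assms(7)
      R[of 0 1 2] L[of 0 2 1] R[of 1 2 0] L[of 1 0 2] R[of 2 0 1]
    by auto
qed

lemma N_iff: "i < 3 \<Longrightarrow> k < 3 \<Longrightarrow> i \<noteq> k \<Longrightarrow> s \<in> N \<longleftrightarrow> F i k s \<in> L"
  unfolding N_def using F_any[of i k s 0 1] F_any[of 0 1 s i k] by auto

lemma N_mult_right: "s \<in> N \<Longrightarrow> s * u \<in> N"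
  using F_right[of 0 1 2 s u] N_iff[of 0 2 "s * u"] by (simp add: N_def)

lemma N_mult_left: "s \<in> N \<Longrightarrow> u * s \<in> N"
  using F_left[of 2 0 1 s u] N_iff[of 2 1 "u * s"] by (simp add: N_def)

lemma N_add: "s \<in> N \<Longrightarrow> u \<in> N \<Longrightarrow> s + u \<in> N"
  by (simp add: N_def F_add L_add)

lemma N_minus: "s \<in> N \<Longrightarrow> - s \<in> N"
  by (simp add: N_def F_minus L_minus)

lemma N_diff: "s \<in> N \<Longrightarrow> u \<in> N \<Longrightarrow> s - u \<in> N"
  using N_add[of s "- u"] N_minus[of u] by simp

lemma N_0: "0 \<in> N"
  using L_0 by (simp add: N_def F_def)

lemma N_sum: "(\<And>i. i \<in> A \<Longrightarrow> f i \<in> N) \<Longrightarrow> sum f A \<in> N"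
  by (induction A rule: infinite_finite_induct) (auto simp: N_0 N_add)

lemma off_diagonal_entry:
  assumes "x \<in> L" "i < 3" "k < 3" "i \<noteq> k"
  shows "t (v i) * x * v k \<in> N"
proof -
  define a where "a = t (v i) * x * v k"
  have ta: "t a = - (t (v k) * x * v i)"
    using L_skew[OF assms(1)] by (simp add: a_def t_simps mult.assoc)
  \<comment> \<open>bracketing with \<open>D i J\<close> and then with \<open>D k J\<close> isolates the \<open>(i, k)\<close> entry\<close>
  have "D i J * x - x * D i J \<in> L"
    by (intro L_bracket t_D t_J assms)
  then have "(D i J * x - x * D i J) * D k J - D k J * (D i J * x - x * D i J) \<in> L"
    by (rule L_bracket'[OF t_D[OF t_J]])
  also have "(D i J * x - x * D i J) * D k J - D k J * (D i J * x - x * D i J) =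
      v i * (J * a * J) * t (v k) + v k * (J * (t (v k) * x * v i) * J) * t (v i)"
    using assms(2-4) by (simp add: D_def a_def algebra_simps v_v v_v_left)
  also have "\<dots> = F i k (J * a * J)"
    by (simp add: F_def t_mult t_J ta mult.assoc)
  finally have "J * a * J \<in> N"
    using N_iff assms by blast
  \<comment> \<open>Multiplying by \<open>J\<close> on both sides undoes the two brackets, because
    \<open>J * J = - 1\<close>.\<close>
  then have "J * (J * a * J) * J \<in> N"
    by (rule N_mult_right[OF N_mult_left])
  also have "J * (J * a * J) * J = (J * J) * a * (J * J)"
    by (simp add: mult.assoc)
  finally show ?thesis
    by (simp add: J_J a_def)
qed

text \<open>For an idempotent \<open>p\<close>, the commutator of \<open>y\<close> and
  \<open>p\<close> times \<open>2 p - 1\<close> is exactly \<open>off p y\<close>, so centrality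
  modulo \<open>N\<close> puts the off-diagonal part into \<open>N\<close>.\<close>

lemma N_off:
  assumes "\<And>u. y * u - u * y \<in> N" "p * p = p"
  shows "off p y \<in> N"
proof -
  have "(y * p - p * y) * (p + p - 1) \<in> N"
    by (intro N_mult_right assms)
  also have "(y * p - p * y) * (p + p - 1) = off p y"
    by (simp add: off_def algebra_simps assms(2) mult_left_eq[OF assms(2)])
  finally show ?thesis .
qed

text \<open>The \<open>(i, k)\<close> entry of the bracket with \<open>F i k u\<close> compares two
  diagonal entries \<open>y\<close> and \<open>z\<close>, and makes \<open>y\<close> central modulo
  \<open>N\<close>. Both summands in the splitting of \<open>y\<close> are then in \<open>N\<close>
  by \<open>N_off\<close>.\<close>

lemma diagonal_entry:
  assumes "x \<in> L" "i < 3"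
  shows "t (v i) * x * v i \<in> N"
proof -
  obtain k :: nat where k: "k < 3" "i \<noteq> k"
    by (metis numeral_3_eq_3 zero_less_Suc zero_neq_one one_less_numeral_iff semiring_norm(77))
  define y z where "y = t (v i) * x * v i" and "z = t (v k) * x * v k"
  have *: "y * u - u * z \<in> N" for u
  proof -
    have "t (v i) * (x * F i k u - F i k u * x) * v k \<in> N"
      using assms k by (intro off_diagonal_entry L_bracket' t_F) auto
    also have "t (v i) * (x * F i k u - F i k u * x) * v k = y * u - u * z"
      using assms(2) k by (simp add: F_def y_def z_def algebra_simps v_v v_v_left)
    finally show ?thesis .
  qed
  have comm: "y * u - u * y \<in> N" for u
  proof -
    \<comment> \<open>The case \<open>u = 1\<close> says that \<open>y\<close> and \<open>z\<close>
      agree modulo \<open>N\<close>, so \<open>z\<close> can be replaced by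
      \<open>y\<close>.\<close>
    have "(y * u - u * z) - u * (y * 1 - 1 * z) \<in> N"
      by (intro N_diff N_mult_left *)
    then show ?thesis
      by (simp add: algebra_simps)
  qed
  have "t y = - y"
    using L_skew[OF assms(1)] by (simp add: y_def t_simps mult.assoc)
  then obtain p q where p: "p * p = p" and q: "q * q = q" and y: "y = off p y + off q (y - off p y)"
    using splitting by blast
  have p': "off p y \<in> N"
    using comm p by (rule N_off)
  \<comment> \<open>Subtracting an element of \<open>N\<close> leaves the remainder central modulo
    \<open>N\<close>, so \<open>N_off\<close> applies a second time.\<close>
  have "(y - off p y) * u - u * (y - off p y) \<in> N" for u
  proof -
    have "(y * u - u * y) - (off p y * u - u * off p y) \<in> N"
      by (intro N_diff comm N_mult_left N_mult_right p')
    then show ?thesis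
      by (simp add: algebra_simps)
  qed
  then have "off q (y - off p y) \<in> N"
    using q by (rule N_off)
  then show ?thesis
    using p' y N_add y_def by metis
qed

lemma entry: "x \<in> L \<Longrightarrow> i < 3 \<Longrightarrow> k < 3 \<Longrightarrow> t (v i) * x * v k \<in> N"
  using diagonal_entry off_diagonal_entry by (cases "i = k") auto

lemma D_off:
  assumes "y \<in> N" "t y = - y" "t p = p" "p * p = p" "i < 3"
  shows "D i (off p y) \<in> L"
proof -
  obtain k :: nat where k: "k < 3" "i \<noteq> k"
    by (metis numeral_3_eq_3 zero_less_Suc zero_neq_one one_less_numeral_iff semiring_norm(77))
  define z where "z = off p y"
  have z: "z \<in> N"
    unfolding z_def off_def by (intro N_add N_diff N_mult_left N_mult_right assms(1))
  have tz: "t z = - z"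
    using assms t_off z_def by simp
  have pzp: "p * (z * p) = 0"
    by (simp add: z_def off_def algebra_simps assms(4) mult_left_eq[OF assms(4)])
  have zp: "z * p + p * z = z"
    by (simp add: z_def off_def algebra_simps assms(4) mult_left_eq[OF assms(4)])
  \<comment> \<open>as \<open>p z p = 0\<close>, the bracket of \<open>F i k (z p)\<close> and \<open>F i k p\<close> has no \<open>(k, k)\<close> entry\<close>
  have "F i k (z * p) \<in> L"
    using z N_mult_right N_iff assms(5) k by blast
  then have "F i k (z * p) * F i k p - F i k p * F i k (z * p) \<in> L"
    by (intro L_bracket' t_F)
  also have "F i k (z * p) * F i k p - F i k p * F i k (z * p) =
      D i (p * t (z * p) - z * p * t p) + D k (t p * (z * p) - t (z * p) * p)"
    using assms(5) k by (rule bracket_F_F_same)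
  also have "p * t (z * p) - z * p * t p = - (z * p + p * z)"
    by (simp add: t_mult assms(3,4) tz mult.assoc mult_left_eq[OF assms(4)])
  also have "t p * (z * p) - t (z * p) * p = 0"
    by (simp add: t_mult assms(3,4) tz mult.assoc pzp)
  finally have "- D i z \<in> L"
    by (simp add: zp D_def)
  then show ?thesis
    using L_minus z_def by fastforce
qed

text \<open>Both summands of the splitting are off-diagonal parts of skew elements of
  \<open>N\<close>, the second because \<open>y - off p y\<close> is again skew and in
  \<open>N\<close>; \<open>D_off\<close> handles each.\<close>

lemma D_in_L:
  assumes "y \<in> N" "t y = - y" "i < 3"
  shows "D i y \<in> L"
proof -
  obtain p q where pq: "t p = p" "p * p = p" "t q = q" "q * q = q"
    and y: "y = off p y + off q (y - off p y)"
    using splitting assms by blast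
  have "off p y \<in> N"
    unfolding off_def by (intro N_add N_diff N_mult_left N_mult_right assms(1))
  then have "y - off p y \<in> N"
    using assms N_diff by blast
  moreover have "t (y - off p y) = - (y - off p y)"
    using t_off pq(1) assms(2) by (simp add: t_diff)
  ultimately have "D i (off q (y - off p y)) \<in> L"
    using D_off pq assms by blast
  moreover have "D i (off p y) \<in> L"
    using D_off pq assms by blast
  moreover have "D i y = D i (off p y) + D i (off q (y - off p y))"
    by (metis D_def distrib_left distrib_right y)
  ultimately show ?thesis
    using L_add by simp
qed

section \<open>Recovering the Lie ideal from an associative ideal\<close>

definition entry_ideal :: "'r set" where
  "entry_ideal = {x. \<forall>i<3. \<forall>k<3. t (v i) * x * v k \<in> N}"

lemma entry_ideal_add: "x \<in> entry_ideal \<Longrightarrow> y \<in> entry_ideal \<Longrightarrow> x + y \<in> entry_ideal"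
  by (simp add: entry_ideal_def algebra_simps N_add)

lemma entry_ideal_minus: "x \<in> entry_ideal \<Longrightarrow> - x \<in> entry_ideal"
  by (simp add: entry_ideal_def N_minus)

lemma entry_ideal_0: "0 \<in> entry_ideal"
  by (simp add: entry_ideal_def N_0)

text \<open>Inserting \<open>v_sum\<close> between the factors gives the rule for matrix products,
  and each summand has a factor in the ideal \<open>N\<close>.\<close>

lemma entry_ideal_mult_left:
  assumes "x \<in> entry_ideal"
  shows "a * x \<in> entry_ideal"
proof -
  have "t (v i) * (a * x) * v k \<in> N" if "i < 3" "k < 3" for i k
  proof -
    have "t (v i) * (a * x) * v k = t (v i) * a * (\<Sum>l<3. v l * t (v l)) * x * v k"
      by (simp add: v_sum mult.assoc)
    also have "\<dots> = (\<Sum>l<3. (t (v i) * a * v l) * (t (v l) * x * v k))"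
      by (simp add: sum_distrib_left sum_distrib_right mult.assoc)
    also have "\<dots> \<in> N"
      using assms that by (intro N_sum N_mult_left[of "t (v _) * x * v k"]) (simp add: entry_ideal_def)
    finally show ?thesis .
  qed
  then show ?thesis
    by (simp add: entry_ideal_def)
qed

lemma entry_ideal_mult_right:
  assumes "x \<in> entry_ideal"
  shows "x * a \<in> entry_ideal"
proof -
  have "t (v i) * (x * a) * v k \<in> N" if "i < 3" "k < 3" for i k
  proof -
    have "t (v i) * (x * a) * v k = t (v i) * x * (\<Sum>l<3. v l * t (v l)) * a * v k"
      by (simp add: v_sum mult.assoc)
    also have "\<dots> = (\<Sum>l<3. (t (v i) * x * v l) * (t (v l) * a * v k))"
      by (simp add: sum_distrib_left sum_distrib_right mult.assoc)
    also have "\<dots> \<in> N"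
      using assms that by (intro N_sum N_mult_right[of "t (v i) * x * v _"]) (simp add: entry_ideal_def)
    finally show ?thesis .
  qed
  then show ?thesis
    by (simp add: entry_ideal_def)
qed

text \<open>A skew matrix is determined by its entries on and above the diagonal: it is a sum of
  \<open>D\<close> and \<open>F\<close> matrices, each of which lies in \<open>L\<close> once its
  entry lies in \<open>N\<close>. The other inclusion is \<open>entry\<close>.\<close>

lemma L_eq: "L = {x \<in> entry_ideal. t x = - x}"
proof (intro Set.set_eqI iffI)
  fix x assume "x \<in> L"
  then show "x \<in> {x \<in> entry_ideal. t x = - x}"
    using entry L_skew by (simp add: entry_ideal_def)
next
  fix x assume "x \<in> {x \<in> entry_ideal. t x = - x}"
  then have x: "\<And>i k. i < 3 \<Longrightarrow> k < 3 \<Longrightarrow> t (v i) * x * v k \<in> N" and tx: "t x = - x"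
    by (auto simp: entry_ideal_def)
  define e where "e i k = t (v i) * x * v k" for i k
  have te: "t (e i k) = - e k i" for i k
    by (simp add: e_def t_mult tx mult.assoc)
  have D: "D i (e i i) \<in> L" if "i < 3" for i
    using that x te by (intro D_in_L) (auto simp: e_def)
  have F: "F i k (e i k) \<in> L" if "i < 3" "k < 3" "i \<noteq> k" for i k
    using that x N_iff[OF that] by (auto simp: e_def)
  have "x = (\<Sum>i<3. v i * t (v i)) * x * (\<Sum>k<3. v k * t (v k))"
    by (simp add: v_sum)
  also have "\<dots> = (\<Sum>i<3. \<Sum>k<3. v i * e i k * t (v k))"
    by (simp add: sum_distrib_left sum_distrib_right mult.assoc e_def eval_nat_numeral distrib_left distrib_right)
  also have "\<dots> = D 0 (e 0 0) + D 1 (e 1 1) + D 2 (e 2 2) + F 0 1 (e 0 1) + F 0 2 (e 0 2) + F 1 2 (e 1 2)"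
    by (simp add: eval_nat_numeral F_def D_def te algebra_simps)
  also have "\<dots> \<in> L"
    by (intro L_add D F) auto
  finally show "x \<in> L" .
qed

end

section \<open>Riesz representation and adjoints\<close>

text \<open>A minimizing sequence is Cauchy by the parallelogram law, because midpoints stay in
  \<open>M\<close>, and its limit lies in the closed set \<open>M\<close>. The infimum
  \<open>d\<close> is one of squared distances, which suits that law.\<close>

lemma ex_nearest_point:
  fixes M :: "'a::{real_inner,complete_space} set"
  assumes M: "subspace M" "closed M"
  shows "\<exists>m\<in>M. \<forall>y\<in>M. norm (x - m) \<le> norm (x - y)"
proof -
  define d where "d = (INF y\<in>M. (norm (x - y))\<^sup>2)"
  have ne: "M \<noteq> {}"
    using M subspace_0 by auto
  have bdd: "bdd_below ((\<lambda>y. (norm (x - y))\<^sup>2) ` M)"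
    by (rule bdd_belowI[of _ 0]) auto
  have d: "d \<le> (norm (x - y))\<^sup>2" if "y \<in> M" for y
    unfolding d_def using bdd that by (rule cINF_lower)
  have "\<exists>y\<in>M. (norm (x - y))\<^sup>2 < d + 1 / real (Suc n)" for n
  proof -
    have "d < d + 1 / real (Suc n)" by simp
    then show ?thesis
      unfolding d_def using cINF_less_iff[OF ne bdd] by blast
  qed
  then obtain s where s: "\<And>n. s n \<in> M" "\<And>n. (norm (x - s n))\<^sup>2 < d + 1 / real (Suc n)"
    by metis
  have gap: "(norm (s p - s q))\<^sup>2 \<le> 2 / real (Suc p) + 2 / real (Suc q)" for p q
  proof -
    have "(1/2) *\<^sub>R (s p + s q) \<in> M"
      using M s by (intro subspace_scale subspace_add) auto
    then have "4 * d \<le> 4 * (norm (x - (1/2) *\<^sub>R (s p + s q)))\<^sup>2"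
      using d by auto
    also have "\<dots> = (norm ((x - s p) + (x - s q)))\<^sup>2"
    proof -
      have "(x - s p) + (x - s q) = 2 *\<^sub>R (x - (1/2) *\<^sub>R (s p + s q))"
        by (simp add: algebra_simps scaleR_2)
      then show ?thesis by (simp add: power_mult_distrib)
    qed
    also have "\<dots> = 2 * (norm (x - s p))\<^sup>2 + 2 * (norm (x - s q))\<^sup>2 - (norm (s p - s q))\<^sup>2"
      by (simp add: power2_norm_eq_inner algebra_simps inner_commute)
    finally show ?thesis
      using s(2)[of p] s(2)[of q] by argo
  qed
  have "Cauchy s"
  proof (rule metric_CauchyI)
    fix e :: real assume "e > 0"
    obtain n where n: "4 / e\<^sup>2 < real n"
      using reals_Archimedean2 by blast
    then have "4 / real (Suc n) < e\<^sup>2"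
      using \<open>e > 0\<close> by (simp add: field_simps)
        (smt (verit, best) mult_left_mono zero_less_power)
    have "dist (s p) (s q) < e" if "p \<ge> n" "q \<ge> n" for p q
    proof -
      have "2 / real (Suc p) \<le> 2 / real (Suc n)" "2 / real (Suc q) \<le> 2 / real (Suc n)"
        using that by (auto intro!: divide_left_mono)
      then have "(norm (s p - s q))\<^sup>2 < e\<^sup>2"
        using gap[of p q] \<open>4 / real (Suc n) < e\<^sup>2\<close> by simp
      then show ?thesis
        using \<open>e > 0\<close> by (simp add: dist_norm power2_less_imp_less)
    qed
    then show "\<exists>n. \<forall>p\<ge>n. \<forall>q\<ge>n. dist (s p) (s q) < e" by blast
  qed
  then obtain m where m: "s \<longlonglongrightarrow> m"
    using Cauchy_convergent convergent_def by blast
  have "m \<in> M"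
    using closed_sequentially[OF M(2) s(1) m] .
  have "(\<lambda>n. d + 1 / real (Suc n)) \<longlonglongrightarrow> d + 0"
    by (intro tendsto_add tendsto_const LIMSEQ_Suc[OF lim_1_over_n])
  moreover have "(\<lambda>n. (norm (x - s n))\<^sup>2) \<longlonglongrightarrow> (norm (x - m))\<^sup>2"
    by (intro tendsto_intros m)
  ultimately have "(norm (x - m))\<^sup>2 \<le> d"
    using s(2) by (intro LIMSEQ_le[of _ _ "\<lambda>n. d + 1 / real (Suc n)"]) (auto intro: less_imp_le)
  then have "norm (x - m) \<le> norm (x - y)" if "y \<in> M" for y
    using d[OF that] by (meson norm_ge_zero order_trans power2_le_imp_le)
  with \<open>m \<in> M\<close> show ?thesis by blast
qed

lemma ex_orthogonal_decomposition:
  fixes M :: "'a::{real_inner,complete_space} set"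
  assumes M: "subspace M" "closed M"
  shows "\<exists>m\<in>M. \<forall>y\<in>M. inner (x - m) y = 0"
proof -
  obtain m where m: "m \<in> M" and le: "\<And>y. y \<in> M \<Longrightarrow> norm (x - m) \<le> norm (x - y)"
    using ex_nearest_point[OF M] by blast
  have "inner (x - m) y = 0" if "y \<in> M" for y
  proof (cases "y = 0")
    case False
    \<comment> \<open>The step along \<open>y\<close> that would reduce the distance to
      \<open>x\<close> most; minimality of \<open>m\<close> forces the gain to vanish.\<close>
    define r where "r = inner (x - m) y / inner y y"
    have "m + r *\<^sub>R y \<in> M"
      using M m that by (simp add: subspace_add subspace_scale)
    then have "(norm (x - m))\<^sup>2 \<le> (norm ((x - m) - r *\<^sub>R y))\<^sup>2"
      using le[of "m + r *\<^sub>R y"] by (simp add: diff_diff_eq power_mono)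
    also have "\<dots> = (norm (x - m))\<^sup>2 - 2 * r * inner (x - m) y + r * r * inner y y"
      by (simp add: power2_norm_eq_inner inner_diff_left inner_diff_right inner_commute)
    also have "r * r * inner y y = r * inner (x - m) y"
      using False by (simp add: r_def)
    finally have "r * inner (x - m) y \<le> 0" by simp
    then have "(inner (x - m) y)\<^sup>2 \<le> 0"
      using False by (simp add: r_def power2_eq_square pos_divide_le_eq)
    then show ?thesis by simp
  qed simp
  with m show ?thesis by blast
qed

lemma ex_orthogonal_projection:
  fixes M :: "'a::{real_inner,complete_space} set"
  assumes M: "subspace M" "closed M"
  shows "\<exists>P :: 'a \<Rightarrow>\<^sub>L 'a. \<forall>x. P x \<in> M \<and> (\<forall>y\<in>M. inner (x - P x) y = 0)"
proof -
  obtain p where p: "\<And>x. p x \<in> M" "\<And>x y. y \<in> M \<Longrightarrow> inner (x - p x) y = 0"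
    using ex_orthogonal_decomposition[OF M] by metis
  \<comment> \<open>The foot of the perpendicular is unique, as the difference of two feet is
    orthogonal to itself; additivity and homogeneity of \<open>p\<close> follow.\<close>
  have uniq: "p x = m" if "m \<in> M" "\<And>y. y \<in> M \<Longrightarrow> inner (x - m) y = 0" for x m
  proof -
    have "p x - m \<in> M"
      using M p that by (simp add: subspace_diff)
    then have "inner ((x - m) - (x - p x)) (p x - m) = 0"
      using that p by (simp only: inner_diff_left[of "x - m"])
    then show ?thesis by simp
  qed
  have "bounded_linear p"
  proof (rule bounded_linear_intro[where K = 1])
    fix x y
    have "inner (x + y - (p x + p y)) z = 0" if "z \<in> M" for z
      using p(2)[OF that, of x] p(2)[OF that, of y] by (simp add: inner_add_left inner_diff_left)
    then show "p (x + y) = p x + p y"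
      using M p by (intro uniq) (auto simp: subspace_add)
  next
    fix r x
    have "inner (r *\<^sub>R x - r *\<^sub>R p x) z = 0" if "z \<in> M" for z
      using p(2)[OF that, of x] by (simp add: inner_diff_left flip: scaleR_diff_right)
    then show "p (r *\<^sub>R x) = r *\<^sub>R p x"
      using M p by (intro uniq) (auto simp: subspace_scale)
  next
    fix x
    have "inner (p x) (p x) = inner x (p x)"
      using p(2)[OF p(1), of x x] by (simp add: inner_diff_left)
    also have "\<dots> \<le> norm x * norm (p x)"
      by (rule norm_cauchy_schwarz)
    finally have "norm (p x) * norm (p x) \<le> norm x * norm (p x)"
      by (simp add: power2_norm_eq_inner[symmetric] power2_eq_square)
    then show "norm (p x) \<le> norm x * 1"
      by (cases "p x = 0") auto
  qed
  then show ?thesis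
    using p by (intro exI[of _ "Blinfun p"]) (auto simp: bounded_linear_Blinfun_apply)
qed

text \<open>If \<open>f\<close> is nonzero, a suitable vector \<open>u\<close> orthogonal to its
  kernel spans a complement of the kernel, so \<open>f\<close> is a multiple of the inner product
  with \<open>u\<close>.\<close>

lemma riesz_representation:
  fixes f :: "'a::{real_inner,complete_space} \<Rightarrow> real"
  assumes "bounded_linear f"
  shows "\<exists>w. \<forall>x. f x = inner x w"
proof (cases "\<forall>x. f x = 0")
  case True
  then show ?thesis by (intro exI[of _ 0]) simp
next
  case False
  interpret f: bounded_linear f by fact
  obtain z where z: "f z \<noteq> 0" using False by blast
  define M where "M = {x. f x = 0}"
  have "subspace M"
    by (simp add: M_def subspace_def f.zero f.add f.scaleR)
  moreover have "closed M"
    unfolding M_def using assms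
    by (intro closed_Collect_eq linear_continuous_on continuous_on_const)
  ultimately obtain m where m: "m \<in> M" "\<And>y. y \<in> M \<Longrightarrow> inner (z - m) y = 0"
    using ex_orthogonal_decomposition by blast
  define u where "u = z - m"
  have fu: "f u \<noteq> 0"
    using m z by (simp add: u_def f.diff M_def)
  then have u: "inner u u \<noteq> 0"
    using f.zero by auto
  have "f x = inner x ((f u / inner u u) *\<^sub>R u)" for x
  proof -
    have "x - (f x / f u) *\<^sub>R u \<in> M"
      using fu by (simp add: M_def f.diff f.scaleR)
    then have "inner u (x - (f x / f u) *\<^sub>R u) = 0"
      using m u_def by simp
    then show ?thesis
      using u fu by (simp add: inner_diff_right inner_commute[of u x] field_simps)
  qed
  then show ?thesis by blast
qed

lemma ex_real_adjoint:
  fixes X :: "'a::{real_inner,complete_space} \<Rightarrow>\<^sub>L 'a"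
  shows "\<exists>Y :: 'a \<Rightarrow>\<^sub>L 'a. \<forall>x y. inner (X x) y = inner x (Y y)"
proof -
  have "\<exists>w. \<forall>x. inner (X x) y = inner x w" for y
    by (intro riesz_representation bounded_linear_intros)
  then obtain g where g: "\<And>x y. inner (X x) y = inner x (g y)"
    by metis
  have eqI: "a = b" if "\<And>x. inner x a = inner x b" for a b :: 'a
    using that by (metis vector_eq_ldot)
  have "bounded_linear g"
  proof (rule bounded_linear_intro[where K = "norm X"])
    show "g (x + y) = g x + g y" for x y
      by (rule eqI) (simp add: g[symmetric] inner_add_right)
    show "g (r *\<^sub>R x) = r *\<^sub>R g x" for r x
      by (rule eqI) (simp add: g[symmetric])
    fix y
    have "norm (g y) * norm (g y) = inner (X (g y)) y"
      by (simp add: g power2_norm_eq_inner[symmetric] power2_eq_square)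
    also have "\<dots> \<le> norm (X (g y)) * norm y"
      by (rule norm_cauchy_schwarz)
    also have "\<dots> \<le> (norm X * norm (g y)) * norm y"
      by (intro mult_right_mono norm_blinfun) simp
    finally show "norm (g y) \<le> norm y * norm X"
      by (cases "g y = 0") (auto simp: mult_ac)
  qed
  then show ?thesis
    using g by (intro exI[of _ "Blinfun g"]) (auto simp: bounded_linear_Blinfun_apply)
qed

lemma Im_cinner: "Im (cinner x y) = inner x (\<i> *\<^sub>C y)" for x y :: "'a::complex_inner"
  by (simp add: inner_eq_Re_cinner cinner_scaleC_right)

lemma inner_scaleC_right: "inner x (a *\<^sub>C y) = inner (cnj a *\<^sub>C x) y" for x y :: "'a::complex_inner"
  by (simp add: inner_eq_Re_cinner cinner_scaleC_right cinner_scaleC_left)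

lemma bounded_ops_scaleC: "X \<in> bounded_ops \<Longrightarrow> X (a *\<^sub>C x) = a *\<^sub>C X x"
  by (simp add: bounded_ops_def)

text \<open>Real adjointness also controls the imaginary parts, because \<open>Im_cinner\<close>
  expresses them through the real inner product and \<open>Y\<close> commutes with
  \<open>\<i>\<close>.\<close>

lemma cinner_adjointI:
  fixes X Y :: "'a::complex_inner \<Rightarrow>\<^sub>L 'a"
  assumes "Y \<in> bounded_ops" "\<And>x y. inner (X x) y = inner x (Y y)"
  shows "cinner (X x) y = cinner x (Y y)"
  using assms by (intro complex_eqI) (simp_all add: Im_cinner bounded_ops_scaleC flip: inner_eq_Re_cinner)

lemma ex_adjoint:
  fixes X :: "'a::complex_hilbert_space \<Rightarrow>\<^sub>L 'a"
  assumes X: "X \<in> bounded_ops"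
  shows "\<exists>Y\<in>bounded_ops. \<forall>x y. cinner (X x) y = cinner x (Y y)"
proof -
  obtain Y :: "'a \<Rightarrow>\<^sub>L 'a" where Y: "\<And>x y. inner (X x) y = inner x (Y y)"
    using ex_real_adjoint by blast
  have "inner x (Y (a *\<^sub>C y)) = inner x (a *\<^sub>C Y y)" for a x y
    by (simp add: inner_scaleC_right bounded_ops_scaleC[OF X] flip: Y)
  then have "Y \<in> bounded_ops"
    by (simp add: bounded_ops_def) (metis vector_eq_ldot)
  then show ?thesis
    using cinner_adjointI Y by blast
qed

lemma adjoint_op:
  fixes X :: "'a::complex_hilbert_space \<Rightarrow>\<^sub>L 'a"
  assumes "X \<in> bounded_ops"
  shows "adjoint_op X \<in> bounded_ops" "cinner (X x) y = cinner x (adjoint_op X y)"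
proof -
  obtain Y where Y: "Y \<in> bounded_ops" "\<And>x y. cinner (X x) y = cinner x (Y y)"
    using ex_adjoint[OF assms] by blast
  have eq: "adjoint_op X = Y"
    by (rule adjoint_op_eqI) (rule Y(2))
  show "adjoint_op X \<in> bounded_ops"
    unfolding eq by (rule Y(1))
  show "cinner (X x) y = cinner x (adjoint_op X y)"
    unfolding eq by (rule Y(2))
qed

text \<open>By Zorn's lemma. Used with orthogonality for a real basis and with the relation on odd
  powers in \<open>ex_anticommuting_projection\<close>.\<close>

lemma ex_maximal_pairwise:
  "\<exists>E\<subseteq>A. pairwise r E \<and> (\<forall>x\<in>A. x \<notin> E \<longrightarrow> (\<exists>y\<in>E. \<not> (r x y \<and> r y x)))"
proof -
  let ?S = "{E. E \<subseteq> A \<and> pairwise r E}"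
  have "\<exists>M\<in>?S. \<forall>X\<in>?S. M \<subseteq> X \<longrightarrow> X = M"
  proof (rule subset_Zorn')
    fix K assume K: "subset.chain ?S K"
    then have "pairwise r (\<Union>K)"
      by (intro pairwise_chain_Union) (auto simp: subset_chain_def chain_subset_def)
    then show "\<Union>K \<in> ?S"
      using K by (auto simp: subset_chain_def)
  qed
  then obtain E where "E \<in> ?S" and "\<forall>X\<in>?S. E \<subseteq> X \<longrightarrow> X = E" ..
  then have E: "E \<subseteq> A" "pairwise r E" and
    max: "\<And>X. X \<subseteq> A \<Longrightarrow> pairwise r X \<Longrightarrow> E \<subseteq> X \<Longrightarrow> X = E"
    by simp_all
  have "\<exists>y\<in>E. \<not> (r x y \<and> r y x)" if "x \<in> A" "x \<notin> E" for x
  proof -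
    have "\<not> pairwise r (insert x E)"
      using that max[of "insert x E"] E(1) by auto
    then show ?thesis
      using E(2) by (auto simp: pairwise_insert)
  qed
  then show ?thesis
    using E by blast
qed

section \<open>Conjugations and transposes\<close>

lemma cinner_zero [simp]: "cinner 0 y = 0" "cinner x 0 = 0" for x y :: "'a::complex_inner"
  using cinner_add_left[of 0 0 y] cinner_add_right[of x 0 0] by simp_all

lemma cinner_minus_left: "cinner (- x) y = - cinner x y" for x y :: "'a::complex_inner"
  using cinner_add_left[of x "- x" y] by (simp add: eq_neg_iff_add_eq_0 add.commute)

lemma cinner_minus_right: "cinner x (- y) = - cinner x y" for x y :: "'a::complex_inner"
  using cinner_add_right[of x y "- y"] by (simp add: eq_neg_iff_add_eq_0 add.commute)

lemma cinner_diff_left: "cinner (x - y) z = cinner x z - cinner y z" for x y z :: "'a::complex_inner"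
  using cinner_add_left[of x "- y" z] by (simp add: cinner_minus_left)

lemma cinner_sum_left: "cinner (sum f A) y = (\<Sum>i\<in>A. cinner (f i) y)" for y :: "'a::complex_inner"
  by (induction A rule: infinite_finite_induct) (simp_all add: cinner_add_left)

lemma cinner_sum_right: "cinner x (sum f A) = (\<Sum>i\<in>A. cinner x (f i))" for x :: "'a::complex_inner"
  by (induction A rule: infinite_finite_induct) (simp_all add: cinner_add_right)

lemma cinner_self: "cinner x x = of_real ((norm x)\<^sup>2)" for x :: "'a::complex_inner"
proof (rule complex_eqI)
  show "Im (cinner x x) = Im (of_real ((norm x)\<^sup>2))"
    using arg_cong[OF cinner_commute[of x x], of Im] by simp
qed (simp add: power2_norm_eq_inner inner_eq_Re_cinner)

lemma eq_if_cinner_left_eq: "x = y" if "\<And>z. cinner z x = cinner z y" for x y :: "'a::complex_inner"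
  by (metis that inner_eq_Re_cinner vector_eq_ldot)

lemma scaleC_minus_one: "(- 1) *\<^sub>C x = - x" for x :: "'a::complex_vector"
  using complex_vector.scale_minus_left[of 1 x] by simp

locale conjugated_space =
  fixes C :: "'a::complex_hilbert_space \<Rightarrow> 'a"
  assumes conjugation: "conjugation C"
begin

lemma C_add: "C (x + y) = C x + C y"
  and C_scaleC: "C (a *\<^sub>C x) = cnj a *\<^sub>C C x"
  and cinner_C_C: "cinner (C x) (C y) = cinner y x"
  using conjugation by (simp_all add: conjugation_def)

lemma C_C [simp]: "C (C x) = x"
  using conjugation by (metis bij_betw_imp_surj_on bij_is_inj conjugation_def inv_into_f_f UNIV_I)

lemma C_minus: "C (- x) = - C x"
  using C_scaleC[of "-1" x] by (simp add: scaleC_minus_one)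

lemma C_diff: "C (x - y) = C x - C y"
  using C_add[of x "- y"] by (simp add: C_minus)

lemma C_zero [simp]: "C 0 = 0"
  using C_diff[of 0 0] by simp

lemma C_scaleR: "C (r *\<^sub>R x) = r *\<^sub>R C x"
  by (simp add: scaleR_scaleC C_scaleC)

lemma inner_C_C: "inner (C x) (C y) = inner x y"
  by (simp add: inner_eq_Re_cinner cinner_C_C) (metis inner_commute inner_eq_Re_cinner)

lemma bounded_linear_C: "bounded_linear C"
  by (rule bounded_linear_intro[where K = 1])
    (simp_all add: C_add C_scaleR norm_eq_sqrt_inner inner_C_C)

text \<open>The transpose is the adjoint for the complex bilinear form \<open>(x, y) \<mapsto> cinner x (C y)\<close>.\<close>

definition transpose_op :: "('a \<Rightarrow>\<^sub>L 'a) \<Rightarrow> ('a \<Rightarrow>\<^sub>L 'a)" where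
  "transpose_op X = Blinfun C o\<^sub>L adjoint_op X o\<^sub>L Blinfun C"

lemma transpose_op_apply: "transpose_op X x = C (adjoint_op X (C x))"
  by (simp add: transpose_op_def bounded_linear_Blinfun_apply bounded_linear_C)

lemma transpose_op_bounded_ops: "X \<in> bounded_ops \<Longrightarrow> transpose_op X \<in> bounded_ops"
  using adjoint_op(1)[of X] by (simp add: bounded_ops_def transpose_op_apply C_scaleC)

lemma transpose_op: "X \<in> bounded_ops \<Longrightarrow> cinner (X x) (C y) = cinner x (C (transpose_op X y))"
  using adjoint_op(2)[of X] by (simp add: transpose_op_apply)

lemma transpose_op_eqI:
  fixes Y :: "'a \<Rightarrow>\<^sub>L 'a"
  assumes "X \<in> bounded_ops" "\<And>x y. cinner (X x) (C y) = cinner x (C (Y y))"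
  shows "transpose_op X = Y"
proof (rule blinfun_eqI)
  fix y
  have "C (transpose_op X y) = C (Y y)"
    by (rule eq_if_cinner_left_eq) (use assms transpose_op in metis)
  then show "transpose_op X y = Y y"
    by (metis C_C)
qed

lemma cinner_C_commute: "cinner x (C y) = cinner y (C x)"
  by (metis C_C cinner_C_C)

lemma transpose_op_involution:
  assumes "X \<in> bounded_ops"
  shows "transpose_op (transpose_op X) = X"
proof (rule transpose_op_eqI[OF transpose_op_bounded_ops[OF assms]])
  fix x y
  have "cinner (transpose_op X x) (C y) = cinner y (C (transpose_op X x))"
    by (rule cinner_C_commute)
  also have "\<dots> = cinner (X y) (C x)"
    by (rule transpose_op[OF assms, symmetric])
  also have "\<dots> = cinner x (C (X y))"
    by (rule cinner_C_commute)
  finally show "cinner (transpose_op X x) (C y) = cinner x (C (X y))" .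
qed

lemma transpose_op_add:
  "X \<in> bounded_ops \<Longrightarrow> Y \<in> bounded_ops \<Longrightarrow> transpose_op (X + Y) = transpose_op X + transpose_op Y"
  by (intro transpose_op_eqI)
    (auto simp: bounded_ops_def blinfun.add_left scaleC_add_right cinner_add_left cinner_add_right C_add transpose_op)

lemma bounded_ops_compose: "X \<in> bounded_ops \<Longrightarrow> Y \<in> bounded_ops \<Longrightarrow> X o\<^sub>L Y \<in> bounded_ops"
  by (simp add: bounded_ops_def)

lemma transpose_op_compose:
  "X \<in> bounded_ops \<Longrightarrow> Y \<in> bounded_ops \<Longrightarrow>
    transpose_op (X o\<^sub>L Y) = transpose_op Y o\<^sub>L transpose_op X"
  by (intro transpose_op_eqI bounded_ops_compose) (simp_all add: transpose_op)

text \<open>Applying \<open>C\<close> to both sides and replacing \<open>x\<close> by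
  \<open>C x\<close> turns the defining identity into one on transposes.\<close>

lemma skew_ops_eq: "skew_ops C = {X \<in> bounded_ops. transpose_op X = - X}"
proof -
  have "(\<forall>x. C (X (C x)) = - adjoint_op X x) \<longleftrightarrow> transpose_op X = - X"
    for X :: "'a \<Rightarrow>\<^sub>L 'a"
  proof
    assume *: "\<forall>x. C (X (C x)) = - adjoint_op X x"
    then have "transpose_op X x = - X x" for x
      using spec[OF *, of "C x"] by (simp add: transpose_op_apply C_minus neg_eq_iff_add_eq_0)
        (metis C_C C_minus minus_minus)
    then show "transpose_op X = - X"
      by (intro blinfun_eqI) (simp add: blinfun.minus_left)
  next
    assume "transpose_op X = - X"
    then have "C (adjoint_op X x) = - X (C x)" for x
      using transpose_op_apply[of X "C x"] by (simp add: blinfun.minus_left)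
    then show "\<forall>x. C (X (C x)) = - adjoint_op X x"
      by (metis C_C C_minus minus_minus)
  qed
  then show ?thesis
    by (auto simp: skew_ops_def)
qed

text \<open>\<open>C\<close> preserves the real inner product, fixes \<open>x\<close> and negates
  \<open>\<i> *\<^sub>C y\<close>, so the value equals its own negative.\<close>

lemma inner_real_imaginary:
  assumes "C x = x" "C y = y"
  shows "inner x (\<i> *\<^sub>C y) = 0"
  using inner_C_C[of x "\<i> *\<^sub>C y"] assms by (simp add: C_scaleC complex_vector.scale_minus_left)

text \<open>Up to factors \<open>2\<close> and \<open>- 2\<close> these are the real and imaginary
  parts of \<open>x\<close>; the scaling keeps fractions out.\<close>

lemma real_part_imaginary_part:
  "C (x + C x) = x + C x" "C (\<i> *\<^sub>C (x - C x)) = \<i> *\<^sub>C (x - C x)"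
  "2 *\<^sub>R x = (x + C x) - \<i> *\<^sub>C (\<i> *\<^sub>C (x - C x))"
  by (simp_all add: C_add C_scaleC C_diff add.commute scaleC_scaleC scaleC_minus_one scaleR_2
      complex_vector.scale_minus_left complex_vector.scale_right_diff_distrib)

text \<open>Let \<open>P\<close> project onto the complexification of a maximal set \<open>E\<close>
  of real vectors related by \<open>r\<close>. Then \<open>Y\<close> maps \<open>E\<close> into the
  orthogonal complement and real vectors orthogonal to \<open>E\<close> into \<open>E\<close>, so
  both diagonal blocks of \<open>Y\<close> with respect to \<open>P\<close> vanish.\<close>

lemma ex_anticommuting_projection:
  assumes Y: "Y \<in> bounded_ops" and skew: "transpose_op Y = - Y"
    and real: "\<And>x. C (Y x) = Y (C x)"
  shows "\<exists>P\<in>bounded_ops. transpose_op P = P \<and> P o\<^sub>L P = P \<and> (\<forall>x. P (C x) = C (P x)) \<and>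
    P o\<^sub>L Y o\<^sub>L P = 0 \<and> Y = (P o\<^sub>L Y) + (Y o\<^sub>L P)"
proof -
  have "cinner (Y x) y = - cinner x (Y y)" for x y
    using transpose_op[OF Y, of x "C y"] by (simp add: skew blinfun.minus_left C_minus cinner_minus_right real)
  then have Y_skew: "inner (Y x) y = - inner x (Y y)" for x y
    by (simp add: inner_eq_Re_cinner)
  define pow where "pow n = (blinfun_apply Y ^^ n)" for n
  have pow_add: "pow (m + n) x = pow m (pow n x)" for m n x
    by (simp add: pow_def funpow_add)
  have pow_1: "pow 1 x = Y x" for x
    by (simp add: pow_def)
  have pow_skew: "inner (pow n x) y = (- 1) ^ n * inner x (pow n y)" for n x y
  proof (induction n arbitrary: x y)
    case (Suc n)
    have "pow (Suc n) z = Y (pow n z)" "pow (Suc n) z = pow n (Y z)" for z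
      using pow_add[of 1 n z] pow_add[of n 1 z] by (simp_all add: pow_1[simplified])
    then show ?case
      using Suc by (metis Y_skew mult_minus_left power_Suc mult.left_commute mult_minus_right mult_1)
  qed (simp add: pow_def)
  \<comment> \<open>Odd powers of a skew map are skew, so \<open>r\<close> is symmetric and holds
    for \<open>x\<close> with itself. Using all of them makes \<open>E\<close> invariant under the
    square of \<open>Y\<close>.\<close>
  define r where "r x y \<longleftrightarrow> (\<forall>k. inner x (pow (2 * k + 1) y) = 0)" for x y
  have r_commute: "r x y \<longleftrightarrow> r y x" for x y
    using pow_skew[of "2 * _ + 1" x y] by (simp add: r_def inner_commute)
  have r_refl: "r x x" for x
    using pow_skew[of "2 * _ + 1" x x] by (simp add: r_def inner_commute)
  obtain E where E: "E \<subseteq> {x. C x = x}" "pairwise r E"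
    and max: "\<forall>x\<in>{x. C x = x}. x \<notin> E \<longrightarrow> (\<exists>y\<in>E. \<not> (r x y \<and> r y x))"
    using ex_maximal_pairwise[of "{x. C x = x}" r] by (elim exE conjE)
  \<comment> \<open>\<open>r\<close> is automatic on the diagonal, so maximality makes \<open>E\<close> equal to its own
    orthogonal complement for \<open>r\<close>\<close>
  have E_eq: "E = {x. C x = x} \<inter> (\<Inter>y\<in>E. \<Inter>k. {x. inner x (pow (2 * k + 1) y) = 0})"
  proof (intro Set.set_eqI iffI)
    fix x assume x: "x \<in> E"
    have "r x y" if "y \<in> E" for y
      using E(2) x that r_refl by (cases "x = y") (auto simp: pairwise_def)
    then show "x \<in> {x. C x = x} \<inter> (\<Inter>y\<in>E. \<Inter>k. {x. inner x (pow (2 * k + 1) y) = 0})"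
      using x E(1) by (auto simp: r_def)
  next
    fix x assume "x \<in> {x. C x = x} \<inter> (\<Inter>y\<in>E. \<Inter>k. {x. inner x (pow (2 * k + 1) y) = 0})"
    then have "C x = x" "\<And>y. y \<in> E \<Longrightarrow> r x y"
      by (auto simp: r_def)
    then show "x \<in> E"
      using max r_commute by blast
  qed
  have in_E: "x \<in> E \<longleftrightarrow> C x = x \<and> (\<forall>y\<in>E. \<forall>k. inner x (pow (2 * k + 1) y) = 0)" for x
    using E_eq by blast
  have "subspace E"
  proof (rule subspaceI)
    show "0 \<in> E"
      by (subst in_E) simp
    fix x y :: 'a and c :: real
    assume x: "x \<in> E"
    show "c *\<^sub>R x \<in> E"
      by (subst in_E) (use iffD1[OF in_E x] in \<open>simp add: C_scaleR\<close>)
    assume y: "y \<in> E"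
    show "x + y \<in> E"
      by (subst in_E) (use iffD1[OF in_E x] iffD1[OF in_E y] in \<open>simp add: C_add inner_add_left\<close>)
  qed
  have "closed E"
    by (subst E_eq) (intro closed_Int closed_INT ballI closed_Collect_eq continuous_intros
      linear_continuous_on[OF bounded_linear_C])
  have E_pow2: "pow 2 x \<in> E" if "x \<in> E" for x
  proof -
    have "inner (pow 2 x) (pow (2 * k + 1) y) = 0" if "y \<in> E" for y k
    proof -
      have "inner x (pow (2 * (k + 1) + 1) y) = 0"
        using iffD1[OF in_E \<open>x \<in> E\<close>] that by blast
      then show ?thesis
        using pow_skew[of 2 x "pow (2 * k + 1) y"] pow_add[of 2 "2 * k + 1" y] by simp
    qed
    moreover have "C (pow 2 x) = pow 2 x"
      using iffD1[OF in_E that] by (simp add: pow_def numeral_2_eq_2 real)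
    ultimately show ?thesis
      by (intro iffD2[OF in_E] conjI ballI allI)
  qed
  have E_pow: "pow (2 * k) x \<in> E" if "x \<in> E" for x k
  proof (induction k)
    case (Suc k)
    then show ?case
      using E_pow2 pow_add[of 2 "2 * k" x] by simp
  qed (simp add: pow_def that)
  have Y_orth: "Y x \<in> E" if "C x = x" "\<And>y. y \<in> E \<Longrightarrow> inner x y = 0" for x
  proof -
    \<comment> \<open>Moving \<open>Y\<close> across turns the odd power into an even one, and even
      powers of \<open>Y\<close> keep \<open>E\<close> invariant.\<close>
    have "inner (Y x) (pow (2 * k + 1) y) = 0" if "y \<in> E" for y k
    proof -
      have "inner x (pow (2 * (k + 1)) y) = 0"
        using that E_pow \<open>\<And>y. y \<in> E \<Longrightarrow> inner x y = 0\<close> by blast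
      then show ?thesis
        using pow_add[of 1 "2 * k + 1" y] by (simp add: Y_skew pow_1[simplified])
    qed
    then show ?thesis
      by (intro iffD2[OF in_E] conjI ballI allI) (use real[of x] that(1) in simp)
  qed
  \<comment> \<open>the complexification of \<open>E\<close>\<close>
  define M where "M = {z. z + C z \<in> E \<and> \<i> *\<^sub>C (z - C z) \<in> E}"
  have E_C: "C x = x" if "x \<in> E" for x
    using iffD1[OF in_E that] by blast
  have E_Y: "inner (Y x) y = 0" if "x \<in> E" "y \<in> E" for x y
  proof -
    have "inner x (pow (2 * 0 + 1) y) = 0"
      using iffD1[OF in_E that(1)] that(2) by blast
    then show ?thesis
      by (simp add: Y_skew pow_1[simplified])
  qed
  have E_M: "x \<in> M" if "x \<in> E" for x
    using that E_C[OF that] \<open>subspace E\<close>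
    by (auto simp: M_def subspace_0 subspace_add)
  have M_i: "\<i> *\<^sub>C z \<in> M" if "z \<in> M" for z
  proof -
    have "\<i> *\<^sub>C z + C (\<i> *\<^sub>C z) = \<i> *\<^sub>C (z - C z)"
      "\<i> *\<^sub>C (\<i> *\<^sub>C z - C (\<i> *\<^sub>C z)) = - (z + C z)"
      by (simp_all add: C_scaleC scaleC_scaleC scaleC_add_right scaleC_minus_one
        complex_vector.scale_right_diff_distrib)
    then show ?thesis
      using that \<open>subspace E\<close> by (simp add: M_def subspace_neg del: minus_add_distrib)
  qed
  have M_C: "C z \<in> M" if "z \<in> M" for z
  proof -
    have "\<i> *\<^sub>C (C z - z) = - (\<i> *\<^sub>C (z - C z))"
      by (simp add: complex_vector.scale_right_diff_distrib)
    then show ?thesis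
      using that \<open>subspace E\<close> by (simp add: M_def subspace_neg add.commute)
  qed
  have "subspace M"
    unfolding subspace_def
  proof (intro conjI allI ballI)
    show "0 \<in> M"
      using \<open>subspace E\<close> by (simp add: M_def subspace_0)
    fix x y :: 'a and c :: real
    assume x: "x \<in> M"
    have "c *\<^sub>R x + C (c *\<^sub>R x) = c *\<^sub>R (x + C x)"
      "\<i> *\<^sub>C (c *\<^sub>R x - C (c *\<^sub>R x)) = c *\<^sub>R (\<i> *\<^sub>C (x - C x))"
      by (simp_all add: scaleR_scaleC C_scaleC scaleC_scaleC scaleC_add_right
        complex_vector.scale_right_diff_distrib mult.commute)
    then show "c *\<^sub>R x \<in> M"
      using x \<open>subspace E\<close> by (simp add: M_def subspace_scale)
    assume y: "y \<in> M"
    have sum_eqs: "x + y + C (x + y) = (x + C x) + (y + C y)"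
      "\<i> *\<^sub>C (x + y - C (x + y)) = \<i> *\<^sub>C (x - C x) + \<i> *\<^sub>C (y - C y)"
      by (simp_all add: C_add algebra_simps scaleC_add_right complex_vector.scale_right_diff_distrib)
    then show "x + y \<in> M"
      using x y \<open>subspace E\<close> unfolding M_def mem_Collect_eq sum_eqs by (blast intro: subspace_add)
  qed
  then have M_scaleC: "a *\<^sub>C z \<in> M" if "z \<in> M" for a z
  proof -
    have "a *\<^sub>C z = Re a *\<^sub>R z + Im a *\<^sub>R (\<i> *\<^sub>C z)"
      by (subst (1) complex_eq[of a])
        (simp add: scaleR_scaleC scaleC_scaleC scaleC_add_left mult.commute)
    then show ?thesis
      using that M_i \<open>subspace M\<close> by (simp add: subspace_add subspace_scale)
  qed
  have "closed M"
  proof -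
    have "M = (\<lambda>z. z + C z) -` E \<inter> (\<lambda>z. \<i> *\<^sub>C (z - C z)) -` E"
      by (auto simp: M_def)
    moreover have "continuous_on UNIV (\<lambda>z. z + C z)" "continuous_on UNIV (\<lambda>z. \<i> *\<^sub>C (z - C z))"
      by (intro linear_continuous_on bounded_linear_add bounded_linear_sub bounded_linear_ident
        bounded_linear_C bounded_linear_compose[OF bounded_linear_scaleC])+
    ultimately show ?thesis
      using \<open>closed E\<close> by (simp add: closed_vimage closed_Int)
  qed
  obtain P :: "'a \<Rightarrow>\<^sub>L 'a" where P: "\<And>x. P x \<in> M" "\<And>x y. y \<in> M \<Longrightarrow> inner (x - P x) y = 0"
    using ex_orthogonal_projection[OF \<open>subspace M\<close> \<open>closed M\<close>] by metis
  have P_eqI: "P x = m" if "m \<in> M" "\<And>y. y \<in> M \<Longrightarrow> inner (x - m) y = 0" for x m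
  proof -
    have "P x - m \<in> M"
      using \<open>subspace M\<close> P that by (simp add: subspace_diff)
    then have "inner ((x - m) - (x - P x)) (P x - m) = 0"
      using that P by (simp only: inner_diff_left[of "x - m"])
    then show ?thesis by simp
  qed
  have P_M: "P x = x" if "x \<in> M" for x
    using that by (intro P_eqI) auto
  have P_bounded: "P \<in> bounded_ops"
    unfolding bounded_ops_def
  proof (intro CollectI allI P_eqI)
    fix a x y assume "y \<in> M"
    then have "inner (a *\<^sub>C (x - P x)) y = 0"
      using P(2)[OF M_scaleC, of y x "cnj a"] inner_scaleC_right[of "x - P x" "cnj a" y] by simp
    then show "inner (a *\<^sub>C x - a *\<^sub>C P x) y = 0"
      by (simp add: complex_vector.scale_right_diff_distrib)
  qed (simp add: M_scaleC P)
  have P_C: "P (C x) = C (P x)" for x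
  proof (rule P_eqI)
    fix y assume "y \<in> M"
    then have "inner (C (x - P x)) (C (C y)) = 0"
      using P(2)[OF M_C] by (simp only: inner_C_C)
    then show "inner (C x - C (P x)) y = 0"
      by (simp add: C_diff)
  qed (simp add: M_C P)
  have "inner (P x) y = inner x (P y)" for x y
    using P(2)[OF P(1), of x y] P(2)[OF P(1), of y x]
    by (simp add: inner_diff_left inner_diff_right inner_commute)
  then have "cinner (P x) y = cinner x (P y)" for x y
    by (rule cinner_adjointI[OF P_bounded])
  then have tP: "transpose_op P = P"
    by (intro transpose_op_eqI P_bounded) (simp add: P_C)
  have PP: "P o\<^sub>L P = P"
    by (rule blinfun_eqI) (simp add: P_M P)
  have "P (Y z) = 0" if z: "z \<in> M" for z
  proof (rule P_eqI)
    fix w assume w: "w \<in> M"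
    define z1 z2 w1 w2 where "z1 = z + C z" and "z2 = \<i> *\<^sub>C (z - C z)"
      and "w1 = w + C w" and "w2 = \<i> *\<^sub>C (w - C w)"
    have E: "z1 \<in> E" "z2 \<in> E" "w1 \<in> E" "w2 \<in> E"
      using z w by (simp_all add: M_def z1_def z2_def w1_def w2_def)
    have r: "C z1 = z1" "C z2 = z2" "C w1 = w1" "C w2 = w2"
      using E E_C by blast+
    \<comment> \<open>In real and imaginary parts the mixed terms vanish by
      \<open>inner_real_imaginary\<close> and the pure ones by \<open>E_Y\<close>.\<close>
    have "4 * inner (Y z) w = inner (Y (2 *\<^sub>R z)) (2 *\<^sub>R w)"
      by (simp add: blinfun.scaleR_right)
    also have "\<dots> = inner (Y z1 - \<i> *\<^sub>C Y z2) (w1 - \<i> *\<^sub>C w2)"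
      by (simp only: real_part_imaginary_part(3) z1_def[symmetric] z2_def[symmetric] w1_def[symmetric]
        w2_def[symmetric] blinfun.diff_right bounded_ops_scaleC[OF Y])
    also have "\<dots> = inner (Y z1) w1 - inner (Y z1) (\<i> *\<^sub>C w2) - inner w1 (\<i> *\<^sub>C Y z2)
        + inner (\<i> *\<^sub>C Y z2) (\<i> *\<^sub>C w2)"
      by (simp add: inner_diff_left inner_diff_right inner_commute)
    also have "inner (\<i> *\<^sub>C Y z2) (\<i> *\<^sub>C w2) = inner (Y z2) w2"
      by (simp add: inner_scaleC_right scaleC_scaleC complex_vector.scale_one)
    also have "inner (Y z1) (\<i> *\<^sub>C w2) = 0"
      by (rule inner_real_imaginary) (simp_all add: r real)
    also have "inner w1 (\<i> *\<^sub>C Y z2) = 0"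
      by (rule inner_real_imaginary) (simp_all add: r real)
    finally show "inner (Y z - 0) w = 0"
      using E E_Y by simp
  qed (simp add: \<open>subspace M\<close> subspace_0)
  then have PYP: "P o\<^sub>L Y o\<^sub>L P = 0"
    by (intro blinfun_eqI) (simp add: P)
  \<comment> \<open>The real and imaginary parts of a vector orthogonal to \<open>M\<close> are
    orthogonal to \<open>E\<close>, so \<open>Y_orth\<close> sends them into
    \<open>E\<close>.\<close>
  have QYQ: "Y z \<in> M" if z: "\<And>y. y \<in> M \<Longrightarrow> inner z y = 0" for z
  proof -
    have zC: "inner (C z) y = 0" if "y \<in> M" for y
      using z[OF M_C[OF that]] inner_C_C[of z "C y"] by simp
    have "inner (\<i> *\<^sub>C z) y = 0" "inner (\<i> *\<^sub>C C z) y = 0" if "y \<in> M" for y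
      using z[OF M_scaleC[OF that, of "cnj \<i>"]] zC[OF M_scaleC[OF that, of "cnj \<i>"]]
      by (simp_all only: inner_scaleC_right complex_cnj_cnj)
    then have z_i: "inner (\<i> *\<^sub>C (z - C z)) y = 0" if "y \<in> E" for y
      using that E_M by (simp add: complex_vector.scale_right_diff_distrib inner_diff_left)
    have "Y (z + C z) \<in> E" "Y (\<i> *\<^sub>C (z - C z)) \<in> E"
      by (rule Y_orth, rule real_part_imaginary_part, simp add: inner_add_left z zC E_M)
        (rule Y_orth, rule real_part_imaginary_part, rule z_i)
    then show ?thesis
      by (simp add: M_def real blinfun.add_right blinfun.diff_right bounded_ops_scaleC[OF Y])
  qed
  have "Y x = P (Y x) + Y (P x)" for x
  proof -
    have "P (Y (x - P x)) = Y (x - P x)"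
      using P(2) by (intro P_M QYQ)
    moreover have "P (Y (P x)) = 0"
      using PYP by (metis blinfun_apply_blinfun_compose zero_blinfun.rep_eq)
    ultimately show ?thesis
      by (simp add: blinfun.diff_right)
  qed
  then have "Y = (P o\<^sub>L Y) + (Y o\<^sub>L P)"
    by (intro blinfun_eqI) (simp add: blinfun.add_left)
  then show ?thesis
    using P_bounded tP PP PYP P_C by blast
qed

end

section \<open>Real orthonormal bases and complementary isometries\<close>

instance complex_hilbert_space \<subseteq> banach ..

text \<open>Distinct members are at distance \<open>sqrt 2\<close>, so choosing for each a point of
  a countable dense set within \<open>1/2\<close> is injective.\<close>

lemma countable_orthonormal:
  fixes E :: "'a::complex_inner set"
  assumes "separable_space (euclidean :: 'a topology)"
    and "\<And>x. x \<in> E \<Longrightarrow> norm x = 1" and "pairwise (\<lambda>x y. inner x y = 0) E"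
  shows "countable E"
proof -
  obtain S :: "'a set" where S: "countable S" "closure S = UNIV"
    using assms(1) unfolding separable_space_def by auto
  have "\<exists>s\<in>S. dist s x < 1/2" for x
    using S(2) closure_approachable[of x S] by (metis UNIV_I half_gt_zero zero_less_one)
  then obtain g where g: "\<And>x. g x \<in> S" "\<And>x. dist (g x) x < 1/2"
    by metis
  have "inj_on g E"
  proof (rule inj_onI, rule ccontr)
    fix x y assume xy: "x \<in> E" "y \<in> E" "g x = g y" "x \<noteq> y"
    have "dist x y \<le> dist (g x) x + dist (g x) y"
      using dist_triangle3 .
    also have "\<dots> < 1"
      using g(2)[of x] g(2)[of y] xy by simp
    finally have "(norm (x - y))\<^sup>2 < 1"
      by (simp add: dist_norm power_less_one_iff abs_square_less_1)
    moreover have "(norm (x - y))\<^sup>2 = 2"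
      using assms(2)[OF xy(1)] assms(2)[OF xy(2)] pairwiseD[OF assms(3) xy(1,2,4)]
      by (simp add: power2_norm_eq_inner inner_diff_left inner_diff_right inner_commute norm_eq_sqrt_inner)
    ultimately show False by simp
  qed
  then show ?thesis
    using S(1) g(1) by (meson countable_image_inj_on countable_subset image_subsetI)
qed

context conjugated_space
begin

text \<open>The assumption on real vectors applies to the real and imaginary parts of
  \<open>x\<close>, which inherit orthogonality to the real set \<open>E\<close>.\<close>

lemma eq_zero_if_real_orthogonal:
  assumes "\<And>x. C x = x \<Longrightarrow> (\<And>y. y \<in> E \<Longrightarrow> inner x y = 0) \<Longrightarrow> x = 0"
    and "\<And>y. y \<in> E \<Longrightarrow> C y = y" and "\<And>y. y \<in> E \<Longrightarrow> cinner x y = 0"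
  shows "x = 0"
proof -
  have x: "inner (a *\<^sub>C x) y = 0" "inner (a *\<^sub>C C x) y = 0" if "y \<in> E" for a y
    using assms(2,3)[OF that] cinner_C_C[of x y] cinner_commute[of y x]
    by (simp_all add: inner_eq_Re_cinner cinner_scaleC_left)
  have "x + C x = 0"
    using x[of _ 1] real_part_imaginary_part
    by (intro assms(1)) (auto simp: inner_add_left complex_vector.scale_one)
  moreover have "\<i> *\<^sub>C (x - C x) = 0"
    using x[of _ \<i>] real_part_imaginary_part
    by (intro assms(1)) (auto simp: inner_diff_left complex_vector.scale_right_diff_distrib)
  ultimately have "2 *\<^sub>R x = 0"
    using real_part_imaginary_part(3)[of x] by simp
  then show ?thesis by simp
qed

text \<open>A maximal real orthonormal set is total, because a nonzero real vector orthogonal to it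
  could be normalized and added. It is countable by separability, and infinite because a finite
  total set would span the space.\<close>

lemma ex_real_orthonormal_basis:
  assumes sep: "separable_space (euclidean :: 'a topology)"
    and inf: "infinite_dimensional TYPE('a)"
  obtains e :: "nat \<Rightarrow> 'a" where "\<And>n. C (e n) = e n"
    and "\<And>m n. cinner (e m) (e n) = (if m = n then 1 else 0)"
    and "\<And>x. (\<And>n. cinner x (e n) = 0) \<Longrightarrow> x = 0"
proof -
  define A where "A = {x. C x = x \<and> norm x = 1}"
  obtain E where E: "E \<subseteq> A" "pairwise (\<lambda>x y. inner x y = 0) E"
    and max: "\<forall>x\<in>A. x \<notin> E \<longrightarrow> (\<exists>y\<in>E. \<not> (inner x y = 0 \<and> inner y x = 0))"
    using ex_maximal_pairwise[of A "\<lambda>x y. inner x y = 0"] by (elim exE conjE)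
  have total: "x = 0" if "C x = x" "\<And>y. y \<in> E \<Longrightarrow> inner x y = 0" for x
  proof (rule ccontr)
    assume "x \<noteq> 0"
    then have "x /\<^sub>R norm x \<in> A"
      using that by (simp add: A_def C_scaleR)
    moreover have "inner (x /\<^sub>R norm x) y = 0" if "y \<in> E" for y
      using \<open>\<And>y. y \<in> E \<Longrightarrow> inner x y = 0\<close>[OF that] by simp
    ultimately have "x /\<^sub>R norm x \<in> E"
      using max by (metis inner_commute)
    then have "inner x (x /\<^sub>R norm x) = 0"
      by (rule that)
    then show False
      using \<open>x \<noteq> 0\<close> by simp
  qed
  have E_real: "C y = y" and E_norm: "norm y = 1" if "y \<in> E" for y
    using E(1) that by (auto simp: A_def)
  have total': "x = 0" if "\<And>y. y \<in> E \<Longrightarrow> cinner x y = 0" for x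
    using eq_zero_if_real_orthogonal[of E x] total E_real that by blast
  have cinner_E: "cinner x y = (if x = y then 1 else 0)" if "x \<in> E" "y \<in> E" for x y
  proof (cases "x = y")
    case False
    then have "inner x y = 0"
      using pairwiseD[OF E(2) that] by simp
    moreover have "inner x (\<i> *\<^sub>C y) = 0"
      using that E_real inner_real_imaginary by blast
    ultimately show ?thesis
      using False by (simp add: complex_eq_iff Im_cinner flip: inner_eq_Re_cinner)
  qed (use that E_norm in \<open>simp add: cinner_self\<close>)
  have "infinite E"
  proof
    assume fin: "finite E"
    have "x \<in> complex_vector.span E" for x
    proof -
      define s where "s = (\<Sum>y\<in>E. cinner x y *\<^sub>C y)"
      have "cinner (x - s) y = 0" if "y \<in> E" for y
      proof -
        have "cinner s y = (\<Sum>z\<in>E. if z = y then cinner x y else 0)"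
          unfolding s_def using that
          by (auto simp: cinner_sum_left cinner_scaleC_left cinner_E intro!: sum.cong)
        then show ?thesis
          using that fin by (simp add: cinner_diff_left)
      qed
      then have "x - s = 0"
        by (rule total')
      moreover have "s \<in> complex_vector.span E"
        unfolding s_def
        by (intro complex_vector.span_sum complex_vector.span_scale complex_vector.span_base)
      ultimately show ?thesis by simp
    qed
    then show False
      using inf fin unfolding infinite_dimensional_def by blast
  qed
  moreover have "countable E"
    using sep E_norm E(2) by (rule countable_orthonormal)
  ultimately have bij: "bij_betw (from_nat_into E) UNIV E"
    by (intro bij_betw_from_nat_into)
  then have in_E: "from_nat_into E n \<in> E" for n
    by (auto simp: bij_betw_def)
  show thesis
  proof
    show "C (from_nat_into E n) = from_nat_into E n" for n
      using in_E E_real by blast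
    show "cinner (from_nat_into E m) (from_nat_into E n) = (if m = n then 1 else 0)" for m n
      using in_E cinner_E bij by (auto simp: bij_betw_def inj_eq)
    show "x = 0" if *: "\<And>n. cinner x (from_nat_into E n) = 0" for x
    proof (rule total')
      fix y assume "y \<in> E"
      then obtain n where "y = from_nat_into E n"
        using bij by (auto simp: bij_betw_def)
      then show "cinner x y = 0"
        using * by simp
    qed
  qed
qed

end

section \<open>Fourier series and isometries between orthonormal sequences\<close>

lemma norm_orthonormal_sum:
  fixes e :: "nat \<Rightarrow> 'a::complex_inner"
  assumes "finite A" "\<And>m n. cinner (e m) (e n) = (if m = n then 1 else 0)"
  shows "(norm (\<Sum>n\<in>A. c n *\<^sub>C e n))\<^sup>2 = (\<Sum>n\<in>A. (cmod (c n))\<^sup>2)"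
proof -
  have "complex_of_real ((norm (\<Sum>n\<in>A. c n *\<^sub>C e n))\<^sup>2) =
      (\<Sum>m\<in>A. cinner (c m *\<^sub>C e m) (\<Sum>n\<in>A. c n *\<^sub>C e n))"
    by (simp only: cinner_self[symmetric] cinner_sum_left)
  also have "\<dots> = (\<Sum>m\<in>A. complex_of_real ((cmod (c m))\<^sup>2))"
  proof (rule sum.cong[OF refl])
    fix m assume "m \<in> A"
    have "cinner (c m *\<^sub>C e m) (\<Sum>n\<in>A. c n *\<^sub>C e n) = (\<Sum>n\<in>A. if n = m then c m * cnj (c m) else 0)"
      by (auto simp: cinner_sum_right cinner_scaleC_left cinner_scaleC_right assms(2) intro!: sum.cong)
    then show "cinner (c m *\<^sub>C e m) (\<Sum>n\<in>A. c n *\<^sub>C e n) = complex_of_real ((cmod (c m))\<^sup>2)"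
      using \<open>m \<in> A\<close> assms(1) by (simp add: complex_norm_square del: of_real_power)
  qed
  finally show ?thesis
    by (simp only: of_real_sum[symmetric] of_real_eq_iff)
qed

lemma bessel_inequality:
  fixes e :: "nat \<Rightarrow> 'a::complex_inner"
  assumes "finite A" "\<And>m n. cinner (e m) (e n) = (if m = n then 1 else 0)"
  shows "(\<Sum>n\<in>A. (cmod (cinner x (e n)))\<^sup>2) \<le> (norm x)\<^sup>2"
proof -
  define s where "s = (\<Sum>n\<in>A. cinner x (e n) *\<^sub>C e n)"
  have "cinner x s = (\<Sum>n\<in>A. complex_of_real ((cmod (cinner x (e n)))\<^sup>2))"
    by (simp add: s_def cinner_sum_right cinner_scaleC_right complex_norm_square mult.commute
      del: of_real_power)
  then have "inner x s = (\<Sum>n\<in>A. (cmod (cinner x (e n)))\<^sup>2)"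
    by (simp add: inner_eq_Re_cinner)
  moreover have "inner s s = (\<Sum>n\<in>A. (cmod (cinner x (e n)))\<^sup>2)"
    unfolding power2_norm_eq_inner[symmetric] s_def by (rule norm_orthonormal_sum[OF assms])
  moreover have "0 \<le> inner (x - s) (x - s)" by simp
  ultimately show ?thesis
    by (simp add: power2_norm_eq_inner inner_diff_left inner_diff_right inner_commute)
qed

text \<open>\<open>W\<close> sends \<open>x\<close> to the series of
  \<open>cinner x (e k) *\<^sub>C f k\<close>; Bessel's inequality makes the coefficients square
  summable, hence the series convergent and \<open>W\<close> a contraction.\<close>

lemma ex_isometry:
  fixes e f :: "nat \<Rightarrow> 'a::complex_hilbert_space"
  assumes e: "\<And>m n. cinner (e m) (e n) = (if m = n then 1 else 0)"
    and f: "\<And>m n. cinner (f m) (f n) = (if m = n then 1 else 0)"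
  shows "\<exists>W\<in>bounded_ops. \<forall>n. W (e n) = f n"
proof -
  define S where "S n x = (\<Sum>k<n. cinner x (e k) *\<^sub>C f k)" for n x
  have "Cauchy (\<lambda>n. S n x)" for x
  proof -
    have "summable (\<lambda>k. (cmod (cinner x (e k)))\<^sup>2)"
      by (rule bounded_imp_summable[where B = "(norm x)\<^sup>2"]) (auto intro: bessel_inequality e)
    then have *: "\<exists>N. \<forall>m\<ge>N. \<forall>n. norm (\<Sum>k=m..<n. (cmod (cinner x (e k)))\<^sup>2) < d" if "d > 0" for d
      using that unfolding summable_Cauchy by blast
    have "summable (\<lambda>k. cinner x (e k) *\<^sub>C f k)"
      unfolding summable_Cauchy
    proof (intro allI impI)
      fix d :: real assume "d > 0"
      then obtain N where N: "\<And>m n. m \<ge> N \<Longrightarrow> (\<Sum>k=m..<n. (cmod (cinner x (e k)))\<^sup>2) < d\<^sup>2"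
        using *[of "d\<^sup>2"] by (auto simp: sum_nonneg)
      have "norm (\<Sum>k=m..<n. cinner x (e k) *\<^sub>C f k) < d" if "m \<ge> N" for m n
        using N[OF that, of n] \<open>d > 0\<close> norm_orthonormal_sum[OF _ f, of "{m..<n}" "\<lambda>k. cinner x (e k)"]
        by (intro power2_less_imp_less[of _ d]) auto
      then show "\<exists>N. \<forall>m\<ge>N. \<forall>n. norm (\<Sum>k=m..<n. cinner x (e k) *\<^sub>C f k) < d"
        by blast
    qed
    then show ?thesis
      unfolding S_def by (intro convergent_Cauchy) (simp add: summable_iff_convergent)
  qed
  then have "(\<lambda>n. S n x) \<longlonglongrightarrow> lim (\<lambda>n. S n x)" for x
    by (simp add: Cauchy_convergent convergent_LIMSEQ_iff[symmetric])
  then obtain w where w: "\<And>x. (\<lambda>n. S n x) \<longlonglongrightarrow> w x"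
    by (intro that)
  have add: "w (x + y) = w x + w y" for x y
  proof (rule LIMSEQ_unique[OF w])
    have "S n (x + y) = S n x + S n y" for n
      by (simp add: S_def cinner_add_left scaleC_add_left sum.distrib)
    then show "(\<lambda>n. S n (x + y)) \<longlonglongrightarrow> w x + w y"
      by (simp add: tendsto_add w)
  qed
  have scale: "w (a *\<^sub>C x) = a *\<^sub>C w x" for a x
  proof (rule LIMSEQ_unique[OF w])
    have "S n (a *\<^sub>C x) = a *\<^sub>C S n x" for n
      by (simp add: S_def cinner_scaleC_left complex_vector.scale_sum_right scaleC_scaleC)
    then show "(\<lambda>n. S n (a *\<^sub>C x)) \<longlonglongrightarrow> a *\<^sub>C w x"
      by (simp add: bounded_linear.tendsto[OF bounded_linear_scaleC] w)
  qed
  have "norm (S n x) \<le> norm x" for n x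
  proof -
    have "(norm (S n x))\<^sup>2 \<le> (norm x)\<^sup>2"
      unfolding S_def by (subst norm_orthonormal_sum[OF _ f]) (auto intro: bessel_inequality e)
    then show ?thesis
      by (rule power2_le_imp_le) simp
  qed
  then have bound: "norm (w x) \<le> norm x" for x
    by (intro LIMSEQ_le_const2[OF tendsto_norm[OF w]]) auto
  have "bounded_linear w"
    by (rule bounded_linear_intro[where K = 1]) (simp_all add: add scale bound scaleR_scaleC)
  moreover have "w (e n) = f n" for n
  proof (rule LIMSEQ_unique[OF w])
    have "S m (e n) = f n" if "m \<ge> Suc n" for m
    proof -
      have "S m (e n) = (\<Sum>k<m. if k = n then f n else 0)"
        unfolding S_def
        by (intro sum.cong) (auto simp: e complex_vector.scale_one)
      then show ?thesis
        using that by simp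
    qed
    then show "(\<lambda>m. S m (e n)) \<longlonglongrightarrow> f n"
      by (intro tendsto_eventually) (auto simp: eventually_sequentially)
  qed
  ultimately show ?thesis
    by (intro bexI[of _ "Blinfun w"]) (simp_all add: bounded_ops_def bounded_linear_Blinfun_apply scale)
qed

context conjugated_space
begin

text \<open>\<open>V\<close> and \<open>W\<close> carry a real orthonormal basis to its even and its
  odd members. As the basis is fixed by \<open>C\<close>, the transpose of each undoes this on its
  own members and kills the others.\<close>

lemma ex_complementary_isometries:
  assumes sep: "separable_space (euclidean :: 'a topology)"
    and inf: "infinite_dimensional TYPE('a)"
  obtains V W where "V \<in> bounded_ops" "W \<in> bounded_ops"
    "transpose_op V o\<^sub>L V = id_blinfun" "transpose_op W o\<^sub>L W = id_blinfun"
    "transpose_op V o\<^sub>L W = 0"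
    "(V o\<^sub>L transpose_op V) + (W o\<^sub>L transpose_op W) = id_blinfun"
proof -
  obtain e :: "nat \<Rightarrow> 'a" where e_real: "\<And>n. C (e n) = e n"
    and e: "\<And>m n. cinner (e m) (e n) = (if m = n then 1 else 0)"
    and total: "\<And>x. (\<And>n. cinner x (e n) = 0) \<Longrightarrow> x = 0"
    using ex_real_orthonormal_basis[OF sep inf] by metis
  have eqI: "x = y" if "\<And>n. cinner x (e n) = cinner y (e n)" for x y
    using total[of "x - y"] that by (simp add: cinner_diff_left)
  \<comment> \<open>Operators that agree on the basis have transposes with the same Fourier
    coefficients; this avoids expanding vectors into series.\<close>
  have op_eqI: "X = Y" if XY: "X \<in> bounded_ops" "Y \<in> bounded_ops" "\<And>n. X (e n) = Y (e n)" for X Y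
  proof -
    have "transpose_op X x = transpose_op Y x" for x
      using transpose_op[OF XY(1), of "e _" x] transpose_op[OF XY(2), of "e _" x] XY(3)
      by (intro eqI) (metis cinner_C_commute e_real)
    then show ?thesis
      using XY(1,2) transpose_op_involution by (metis blinfun_eqI)
  qed
  have t: "cinner (transpose_op X x) (e n) = cinner (X (e n)) (C x)" if "X \<in> bounded_ops" for X x n
    using transpose_op[OF that, of "e n" x] by (metis cinner_C_commute e_real)
  obtain V :: "'a \<Rightarrow>\<^sub>L 'a" where V: "V \<in> bounded_ops" "\<And>n. V (e n) = e (2 * n)"
    using ex_isometry[of e "\<lambda>n. e (2 * n)"] e by auto
  obtain W :: "'a \<Rightarrow>\<^sub>L 'a" where W: "W \<in> bounded_ops" "\<And>n. W (e n) = e (2 * n + 1)"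
    using ex_isometry[of e "\<lambda>n. e (2 * n + 1)"] e by auto
  have parity: "2 * m \<noteq> Suc (2 * n)" "Suc (2 * n) \<noteq> 2 * m" for m n :: nat
    by presburger+
  have tV: "transpose_op V (e (2 * n)) = e n" "transpose_op V (e (2 * n + 1)) = 0" for n
    by (intro eqI; simp add: t V e e_real parity)+
  have tW: "transpose_op W (e (2 * n)) = 0" "transpose_op W (e (2 * n + 1)) = e n" for n
    by (intro eqI; simp add: t W e e_real parity)+
  have b: "transpose_op V \<in> bounded_ops" "transpose_op W \<in> bounded_ops" "id_blinfun \<in> (bounded_ops :: ('a \<Rightarrow>\<^sub>L 'a) set)"
      "0 \<in> (bounded_ops :: ('a \<Rightarrow>\<^sub>L 'a) set)"
    using V W transpose_op_bounded_ops by (auto simp: bounded_ops_def)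
  show thesis
  proof
    show "(V o\<^sub>L transpose_op V) + (W o\<^sub>L transpose_op W) = id_blinfun"
    proof (rule op_eqI)
      fix n
      show "((V o\<^sub>L transpose_op V) + (W o\<^sub>L transpose_op W)) (e n) = id_blinfun (e n)"
        using tV[of "n div 2"] tW[of "n div 2"]
        by (cases "even n") (auto simp: V W blinfun.add_left elim!: evenE oddE)
    qed (use V W b in \<open>auto simp: bounded_ops_def blinfun.add_left scaleC_add_right\<close>)
  qed (use V W tV tW b in \<open>auto intro!: op_eqI bounded_ops_compose\<close>)
qed

end

section \<open>The ring of bounded complex-linear operators\<close>

lemmas blinfun_simps = blinfun.add_left blinfun.add_right blinfun.diff_left blinfun.diff_right
  blinfun.minus_left blinfun.minus_right scaleC_blinfun.rep_eq

lemma bounded_ops_closed: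
  "0 \<in> bounded_ops" "id_blinfun \<in> bounded_ops"
  "X \<in> bounded_ops \<Longrightarrow> Y \<in> bounded_ops \<Longrightarrow> X + Y \<in> bounded_ops"
  "X \<in> bounded_ops \<Longrightarrow> Y \<in> bounded_ops \<Longrightarrow> X - Y \<in> bounded_ops"
  "X \<in> bounded_ops \<Longrightarrow> - X \<in> bounded_ops"
  "X \<in> bounded_ops \<Longrightarrow> a *\<^sub>C X \<in> bounded_ops"
  by (simp_all add: bounded_ops_def blinfun_simps scaleC_add_right scaleC_scaleC mult.commute
    complex_vector.scale_right_diff_distrib)

text \<open>The counterpart of \<open>off\<close> for operators not yet collected in a ring type;
  \<open>Rep_off\<close> links the two.\<close>

definition off_op :: "('a::complex_inner \<Rightarrow>\<^sub>L 'a) \<Rightarrow> ('a \<Rightarrow>\<^sub>L 'a) \<Rightarrow> ('a \<Rightarrow>\<^sub>L 'a)" where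
  "off_op P X = (P o\<^sub>L X) + (X o\<^sub>L P) - ((P o\<^sub>L X o\<^sub>L P) + (P o\<^sub>L X o\<^sub>L P))"

lemma off_op_apply: "off_op P X x = P (X x) + X (P x) - (P (X (P x)) + P (X (P x)))"
  by (simp add: off_op_def blinfun_simps)

lemma off_op_closed: "P \<in> bounded_ops \<Longrightarrow> X \<in> bounded_ops \<Longrightarrow> off_op P X \<in> bounded_ops"
  unfolding off_op_def by (intro bounded_ops_closed) (simp_all add: bounded_ops_def blinfun_simps)

lemma off_op_linear:
  assumes "P \<in> bounded_ops"
  shows "off_op P (X + a *\<^sub>C Y) = off_op P X + a *\<^sub>C off_op P Y"
  by (rule blinfun_eqI)
    (simp add: off_op_apply blinfun_simps bounded_ops_scaleC[OF assms] scaleC_add_right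
      complex_vector.scale_right_diff_distrib)

context conjugated_space
begin

lemma transpose_op_scaleC: "X \<in> bounded_ops \<Longrightarrow> transpose_op (a *\<^sub>C X) = a *\<^sub>C transpose_op X"
  by (intro transpose_op_eqI bounded_ops_closed)
    (simp_all add: blinfun_simps cinner_scaleC_left cinner_scaleC_right C_scaleC transpose_op)

lemma transpose_op_minus: "X \<in> bounded_ops \<Longrightarrow> transpose_op (- X) = - transpose_op X"
  using transpose_op_scaleC[of X "- 1"] by (simp add: scaleC_minus_one)

lemma transpose_op_diff:
  "X \<in> bounded_ops \<Longrightarrow> Y \<in> bounded_ops \<Longrightarrow> transpose_op (X - Y) = transpose_op X - transpose_op Y"
  using transpose_op_add[of X "- Y"] by (simp add: transpose_op_minus bounded_ops_closed)

lemma transpose_op_off_op: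
  assumes "P \<in> bounded_ops" "X \<in> bounded_ops" "transpose_op P = P" "transpose_op X = - X"
  shows "transpose_op (off_op P X) = - off_op P X"
  unfolding off_op_def
  by (simp add: assms transpose_op_add transpose_op_diff transpose_op_compose bounded_ops_compose
    bounded_ops_closed) (rule blinfun_eqI, simp add: blinfun_simps)

lemma ex_real_imaginary_skew:
  assumes X: "X \<in> bounded_ops" and skew: "transpose_op X = - X"
  obtains R S where "R \<in> bounded_ops" "transpose_op R = - R" "\<forall>x. R (C x) = C (R x)"
    "S \<in> bounded_ops" "transpose_op S = - S" "\<forall>x. S (C x) = C (S x)"
    "2 *\<^sub>C X = R + \<i> *\<^sub>C S"
proof -
  \<comment> \<open>The complex conjugate of \<open>X\<close>, again skew; \<open>X + X'\<close> and
    \<open>\<i> *\<^sub>C (X' - X)\<close> are twice the real and imaginary parts of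
    \<open>X\<close>.\<close>
  define X' where "X' = Blinfun C o\<^sub>L X o\<^sub>L Blinfun C"
  have X'_apply: "X' x = C (X (C x))" for x
    by (simp add: X'_def bounded_linear_Blinfun_apply bounded_linear_C)
  have X': "X' \<in> bounded_ops"
    using X by (simp add: bounded_ops_def X'_apply C_scaleC)
  have skew': "transpose_op X' = - X'"
  proof (rule transpose_op_eqI[OF X'])
    fix x y
    have "cinner (X' x) (C y) = cnj (cinner (X (C x)) (C (C y)))"
      by (simp add: X'_apply cinner_C_C flip: cinner_commute)
    also have "\<dots> = - cnj (cinner (C x) (C (X (C y))))"
      by (simp only: transpose_op[OF X] skew blinfun.minus_left C_minus cinner_minus_right complex_cnj_minus)
    also have "\<dots> = - cinner x (X (C y))"
      by (simp add: cinner_C_C flip: cinner_commute)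
    finally show "cinner (X' x) (C y) = cinner x (C ((- X') y))"
      by (simp add: blinfun_simps X'_apply C_minus cinner_minus_right)
  qed
  show thesis
  proof
    show "2 *\<^sub>C X = (X + X') + \<i> *\<^sub>C (\<i> *\<^sub>C (X' - X))"
      using scaleC_add_left[of 1 1 X]
      by (simp add: scaleC_scaleC scaleC_minus_one scaleC_one)
    show "\<forall>x. (X + X') (C x) = C ((X + X') x)"
      "\<forall>x. (\<i> *\<^sub>C (X' - X)) (C x) = C ((\<i> *\<^sub>C (X' - X)) x)"
      by (simp_all add: blinfun_simps X'_apply C_add C_diff C_scaleC complex_vector.scale_minus_left
        complex_vector.scale_right_diff_distrib)
    show "transpose_op (X + X') = - (X + X')"
      by (simp add: transpose_op_add X X' skew skew')
    show "transpose_op (\<i> *\<^sub>C (X' - X)) = - (\<i> *\<^sub>C (X' - X))"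
      by (simp add: transpose_op_scaleC transpose_op_diff bounded_ops_closed X X' skew skew'
        complex_vector.scale_right_diff_distrib)
  qed (intro bounded_ops_closed X X')+
qed

text \<open>\<open>P\<close> is chosen for the real part \<open>R\<close>, so that
  \<open>off_op P\<close> captures it entirely; \<open>Q\<close> is chosen for what is left of the
  imaginary part, which is still skew and commutes with \<open>C\<close>.\<close>

lemma ex_skew_splitting:
  assumes X: "X \<in> bounded_ops" and skew: "transpose_op X = - X"
  obtains P Q where "P \<in> bounded_ops" "transpose_op P = P" "P o\<^sub>L P = P"
    "Q \<in> bounded_ops" "transpose_op Q = Q" "Q o\<^sub>L Q = Q"
    "X = off_op P X + off_op Q (X - off_op P X)"
proof -
  obtain R S where R: "R \<in> bounded_ops" "transpose_op R = - R" "\<forall>x. R (C x) = C (R x)"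
    and S: "S \<in> bounded_ops" "transpose_op S = - S" "\<forall>x. S (C x) = C (S x)"
    and RS: "2 *\<^sub>C X = R + \<i> *\<^sub>C S"
    using ex_real_imaginary_skew[OF assms] .
  have ex: "\<exists>P\<in>bounded_ops. transpose_op P = P \<and> P o\<^sub>L P = P \<and> (\<forall>x. P (C x) = C (P x)) \<and>
      off_op P Y = Y"
    if "Y \<in> bounded_ops" "transpose_op Y = - Y" "\<forall>x. Y (C x) = C (Y x)" for Y
  proof -
    have "\<exists>P\<in>bounded_ops. transpose_op P = P \<and> P o\<^sub>L P = P \<and> (\<forall>x. P (C x) = C (P x)) \<and>
        P o\<^sub>L Y o\<^sub>L P = 0 \<and> Y = (P o\<^sub>L Y) + (Y o\<^sub>L P)"
      using that by (intro ex_anticommuting_projection) simp_all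
    then show ?thesis
      unfolding off_op_def by (elim bexE conjE, intro bexI conjI) simp_all
  qed
  obtain P where P: "P \<in> bounded_ops" "transpose_op P = P" "P o\<^sub>L P = P" "\<And>x. P (C x) = C (P x)"
    "off_op P R = R"
    using ex[OF R] by blast
  define T where "T = S - off_op P S"
  have T: "T \<in> bounded_ops"
    unfolding T_def by (intro bounded_ops_closed off_op_closed S P)
  have "transpose_op T = - T"
    by (simp add: T_def transpose_op_diff transpose_op_off_op off_op_closed S P)
  moreover have "\<forall>x. T (C x) = C (T x)"
    by (simp add: T_def off_op_apply blinfun_simps S P C_add C_diff)
  ultimately obtain Q where Q: "Q \<in> bounded_ops" "transpose_op Q = Q" "Q o\<^sub>L Q = Q" "off_op Q T = T"
    using ex[OF T] by blast
  have 0: "off_op P' 0 = 0" for P' :: "'a \<Rightarrow>\<^sub>L 'a"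
    by (rule blinfun_eqI) (simp add: off_op_apply)
  have scale: "off_op P' (a *\<^sub>C Y) = a *\<^sub>C off_op P' Y" if "P' \<in> bounded_ops"
    for P' Y :: "'a \<Rightarrow>\<^sub>L 'a" and a
    using off_op_linear[OF that, of 0 a Y] by (simp add: 0)
  have "2 *\<^sub>C off_op P X = R + \<i> *\<^sub>C off_op P S"
    using off_op_linear[OF P(1), of R \<i> S] scale[OF P(1), of 2 X] by (simp add: P(5) RS)
  then have *: "2 *\<^sub>C (X - off_op P X) = \<i> *\<^sub>C T"
    by (simp add: complex_vector.scale_right_diff_distrib RS T_def)
  then have "2 *\<^sub>C off_op Q (X - off_op P X) = \<i> *\<^sub>C T"
    using scale[OF Q(1)] Q(4) by metis
  then have "2 *\<^sub>C (off_op P X + off_op Q (X - off_op P X)) = 2 *\<^sub>C X"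
    using * by (simp add: scaleC_add_right complex_vector.scale_right_diff_distrib diff_eq_eq add.commute)
  then have "X = off_op P X + off_op Q (X - off_op P X)"
    by (metis complex_vector.scale_left_imp_eq zero_neq_numeral)
  then show thesis
    using that P Q by blast
qed

end

text \<open>A type of complex-linear operators makes the class-based results on rings with
  involution applicable.\<close>

typedef (overloaded) 'a bop = "bounded_ops :: ('a::complex_inner \<Rightarrow>\<^sub>L 'a) set"
  using bounded_ops_closed by blast

setup_lifting type_definition_bop

instantiation bop :: (complex_inner) "{ring,monoid_mult}"
begin

lift_definition zero_bop :: "'a bop" is 0 by (rule bounded_ops_closed)
lift_definition one_bop :: "'a bop" is id_blinfun by (rule bounded_ops_closed)
lift_definition plus_bop :: "'a bop \<Rightarrow> 'a bop \<Rightarrow> 'a bop" is "(+)" by (rule bounded_ops_closed)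
lift_definition minus_bop :: "'a bop \<Rightarrow> 'a bop \<Rightarrow> 'a bop" is "(-)" by (rule bounded_ops_closed)
lift_definition uminus_bop :: "'a bop \<Rightarrow> 'a bop" is uminus by (rule bounded_ops_closed)
lift_definition times_bop :: "'a bop \<Rightarrow> 'a bop \<Rightarrow> 'a bop" is "(o\<^sub>L)"
  by (simp add: bounded_ops_def)

instance
  by standard (transfer; (rule blinfun_eqI)?; simp add: blinfun_simps)+

end

section \<open>Transposition on the operator ring and the two implications\<close>

context conjugated_space
begin

definition transpose_bop :: "'a bop \<Rightarrow> 'a bop" where
  "transpose_bop X = Abs_bop (transpose_op (Rep_bop X))"

lemma Rep_transpose_bop: "Rep_bop (transpose_bop X) = transpose_op (Rep_bop X)"
  by (simp add: transpose_bop_def Abs_bop_inverse transpose_op_bounded_ops Rep_bop)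

lemmas Rep_bop_simps = zero_bop.rep_eq one_bop.rep_eq plus_bop.rep_eq minus_bop.rep_eq
  uminus_bop.rep_eq times_bop.rep_eq Rep_transpose_bop

lemma Rep_off: "Rep_bop (off p x) = off_op (Rep_bop p) (Rep_bop x)"
  by (simp add: off_def off_op_def Rep_bop_simps)

text \<open>The even and odd isometries supply \<open>w\<^sub>1\<close> and
  \<open>w\<^sub>2\<close>; \<open>ex_skew_splitting\<close> supplies
  \<open>splitting\<close>.\<close>

lemma ex_split_involution:
  assumes "separable_space (euclidean :: 'a topology)" "infinite_dimensional TYPE('a)"
  shows "\<exists>v w. split_involution transpose_bop v w"
proof -
  obtain V W where VW: "V \<in> bounded_ops" "W \<in> bounded_ops"
    "transpose_op V o\<^sub>L V = id_blinfun" "transpose_op W o\<^sub>L W = id_blinfun"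
    "transpose_op V o\<^sub>L W = 0"
    "(V o\<^sub>L transpose_op V) + (W o\<^sub>L transpose_op W) = id_blinfun"
    using ex_complementary_isometries[OF assms] .
  have "split_involution transpose_bop (Abs_bop V) (Abs_bop W)"
  proof
    fix x y :: "'a bop"
    show "transpose_bop (x + y) = transpose_bop x + transpose_bop y"
      "transpose_bop (x * y) = transpose_bop y * transpose_bop x"
      "transpose_bop (transpose_bop x) = x"
      by (simp_all add: Rep_bop_simps transpose_op_add transpose_op_compose transpose_op_involution
        Rep_bop flip: Rep_bop_inject)
    assume "transpose_bop x = - x"
    then have "transpose_op (Rep_bop x) = - Rep_bop x"
      by (simp add: Rep_bop_simps flip: Rep_bop_inject)
    then obtain P Q where PQ: "P \<in> bounded_ops" "transpose_op P = P" "P o\<^sub>L P = P"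
      "Q \<in> bounded_ops" "transpose_op Q = Q" "Q o\<^sub>L Q = Q"
      "Rep_bop x = off_op P (Rep_bop x) + off_op Q (Rep_bop x - off_op P (Rep_bop x))"
      by (rule ex_skew_splitting[OF Rep_bop])
    show "\<exists>p q. transpose_bop p = p \<and> p * p = p \<and> transpose_bop q = q \<and> q * q = q \<and>
        x = off p x + off q (x - off p x)"
      by (rule exI[of _ "Abs_bop P"], rule exI[of _ "Abs_bop Q"])
        (use PQ in \<open>simp add: Rep_bop_simps Rep_off Abs_bop_inverse flip: Rep_bop_inject\<close>)
  qed (use VW in \<open>simp_all add: Rep_bop_simps Abs_bop_inverse flip: Rep_bop_inject\<close>)
  then show ?thesis by blast
qed

lemma skew_ops_Rep: "Rep_bop x \<in> skew_ops C \<longleftrightarrow> transpose_bop x = - x"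
  by (simp add: skew_ops_eq Rep_bop Rep_bop_simps flip: Rep_bop_inject)

lemma skew_ops_commutator:
  assumes "A \<in> skew_ops C" "X \<in> skew_ops C"
  shows "commutator A X \<in> skew_ops C"
proof -
  have A: "A \<in> bounded_ops" "transpose_op A = - A" and X: "X \<in> bounded_ops" "transpose_op X = - X"
    using assms by (auto simp: skew_ops_eq)
  have "(- X o\<^sub>L - A) - (- A o\<^sub>L - X) = - ((A o\<^sub>L X) - (X o\<^sub>L A))"
    by (rule blinfun_eqI) (simp add: blinfun_simps)
  then show ?thesis
    using A X by (simp add: skew_ops_eq commutator_def transpose_op_diff transpose_op_compose
      bounded_ops_compose bounded_ops_closed)
qed

lemma skew_ops_subspace: "complex_vector.subspace (skew_ops C)"
proof -
  have "transpose_op 0 = 0"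
    using transpose_op_diff[of id_blinfun id_blinfun] by (simp add: bounded_ops_closed)
  then show ?thesis
    by (auto simp: complex_vector.subspace_def skew_ops_eq bounded_ops_closed transpose_op_add
      transpose_op_scaleC complex_vector.scale_minus_right)
qed

lemma lie_ideal_of_ideal:
  assumes "ideal I (bounded_ops_ring :: ('a \<Rightarrow>\<^sub>L 'a) ring)"
  shows "lie_ideal (I \<inter> skew_ops C) (skew_ops C)"
proof -
  interpret ideal I "bounded_ops_ring :: ('a \<Rightarrow>\<^sub>L 'a) ring" by fact
  have I_sub: "I \<subseteq> bounded_ops"
    using a_subset by (simp add: bounded_ops_ring_def)
  have add: "X + Y \<in> I" if "X \<in> I" "Y \<in> I" for X Y
    using additive_subgroup.a_closed[OF is_additive_subgroup that] by (simp add: bounded_ops_ring_def)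
  have zero: "0 \<in> I"
    using additive_subgroup.zero_closed[OF is_additive_subgroup] by (simp add: bounded_ops_ring_def)
  have left: "A o\<^sub>L X \<in> I" and right: "X o\<^sub>L A \<in> I" if "X \<in> I" "A \<in> bounded_ops" for A X
    using I_l_closed[of X A] I_r_closed[of X A] that by (simp_all add: bounded_ops_ring_def)
  have scale: "a *\<^sub>C X \<in> I" if "X \<in> I" for a X
  proof -
    \<comment> \<open>Scaling is composition with a multiple of the identity, so a ring ideal is
      closed under complex scalars.\<close>
    have "(a *\<^sub>C id_blinfun) o\<^sub>L X = a *\<^sub>C X"
      by (rule blinfun_eqI) (simp add: blinfun_simps)
    then show ?thesis
      using left[OF that, of "a *\<^sub>C id_blinfun"] by (simp add: bounded_ops_closed)
  qed
  have "complex_vector.subspace (I \<inter> skew_ops C)"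
    using skew_ops_subspace add zero scale by (auto simp: complex_vector.subspace_def)
  moreover have "commutator A X \<in> I" if "A \<in> skew_ops C" "X \<in> I" for A X
  proof -
    have A: "A \<in> bounded_ops"
      using that by (simp add: skew_ops_eq)
    have "(A o\<^sub>L X) + (- 1) *\<^sub>C (X o\<^sub>L A) \<in> I"
      by (intro add scale left right that A)
    then show ?thesis
      by (simp add: commutator_def scaleC_minus_one)
  qed
  ultimately show ?thesis
    using skew_ops_commutator by (simp add: lie_ideal_def)
qed

lemma ideal_Rep_image:
  assumes "0 \<in> I" "\<And>x y. x \<in> I \<Longrightarrow> y \<in> I \<Longrightarrow> x + y \<in> I" "\<And>x. x \<in> I \<Longrightarrow> - x \<in> I"
    and "\<And>a x. x \<in> I \<Longrightarrow> a * x \<in> I" "\<And>a x. x \<in> I \<Longrightarrow> x * a \<in> I"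
  shows "ideal (Rep_bop ` I) (bounded_ops_ring :: ('a \<Rightarrow>\<^sub>L 'a) ring)"
proof (rule idealI[OF ring_bounded_ops_ring])
  interpret R: ring "bounded_ops_ring :: ('a \<Rightarrow>\<^sub>L 'a) ring"
    by (rule ring_bounded_ops_ring)
  have *: "Rep_bop x \<in> carrier bounded_ops_ring" for x :: "'a bop"
    using Rep_bop by (simp add: bounded_ops_ring_def)
  have minus: "\<ominus>\<^bsub>bounded_ops_ring\<^esub> Rep_bop x = Rep_bop (- x)" for x :: "'a bop"
    using * by (intro R.minus_equality)
      (simp_all add: bounded_ops_ring_def Rep_bop_simps bounded_ops_closed Rep_bop)
  show "subgroup (Rep_bop ` I) (add_monoid bounded_ops_ring)"
  proof (rule R.add.subgroupI)
    show "Rep_bop ` I \<subseteq> carrier bounded_ops_ring"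
      using * by blast
    show "Rep_bop ` I \<noteq> {}"
      using assms(1) by blast
    show "\<ominus>\<^bsub>bounded_ops_ring\<^esub> X \<in> Rep_bop ` I" if "X \<in> Rep_bop ` I" for X
      using that assms(3) minus by auto
    show "X \<oplus>\<^bsub>bounded_ops_ring\<^esub> Y \<in> Rep_bop ` I" if "X \<in> Rep_bop ` I" "Y \<in> Rep_bop ` I" for X Y
      using that assms(2) by (auto simp: bounded_ops_ring_def simp flip: plus_bop.rep_eq)
  qed
  fix X A :: "'a \<Rightarrow>\<^sub>L 'a"
  assume "X \<in> Rep_bop ` I" "A \<in> carrier bounded_ops_ring"
  then obtain x a where xa: "x \<in> I" "X = Rep_bop x" "A = Rep_bop a"
    by (auto simp: bounded_ops_ring_def elim: Rep_bop_cases)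
  show "A \<otimes>\<^bsub>bounded_ops_ring\<^esub> X \<in> Rep_bop ` I" "X \<otimes>\<^bsub>bounded_ops_ring\<^esub> A \<in> Rep_bop ` I"
    using assms(4,5) xa by (auto simp: bounded_ops_ring_def simp flip: times_bop.rep_eq)
qed

lemma ideal_of_lie_ideal:
  assumes "separable_space (euclidean :: 'a topology)" "infinite_dimensional TYPE('a)"
    and L: "lie_ideal L (skew_ops C)"
  shows "\<exists>I. ideal I (bounded_ops_ring :: ('a \<Rightarrow>\<^sub>L 'a) ring) \<and> L = I \<inter> skew_ops C"
proof -
  obtain v w where vw: "split_involution transpose_bop v w"
    using ex_split_involution[OF assms(1,2)] by blast
  define L' where "L' = {x. Rep_bop x \<in> L}"
  have sub: "L \<subseteq> skew_ops C" and subspace: "complex_vector.subspace L"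
    and bracket: "\<And>A X. A \<in> skew_ops C \<Longrightarrow> X \<in> L \<Longrightarrow> commutator A X \<in> L"
    using L by (auto simp: lie_ideal_def)
  \<comment> \<open>Every member of \<open>L\<close> is complex linear, so no element is lost in
    passing to \<open>bop\<close>.\<close>
  have L_image: "L = Rep_bop ` L'"
    using sub by (force simp: L'_def skew_ops_eq elim: Rep_bop_cases)
  interpret split_involution transpose_bop v w by fact
  interpret lie_ideal_of_skew transpose_bop v w L'
  proof
    show "transpose_bop x = - x" if "x \<in> L'" for x
      using that sub skew_ops_Rep by (auto simp: L'_def)
    show "a * x - x * a \<in> L'" if "transpose_bop a = - a" "x \<in> L'" for a x
      using that bracket[of "Rep_bop a" "Rep_bop x"] skew_ops_Rep
      by (simp add: L'_def commutator_def Rep_bop_simps)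
  qed (use subspace complex_vector.subspace_neg in
    \<open>auto simp: L'_def Rep_bop_simps complex_vector.subspace_0 complex_vector.subspace_add\<close>)
  have "ideal (Rep_bop ` entry_ideal) (bounded_ops_ring :: ('a \<Rightarrow>\<^sub>L 'a) ring)"
    by (intro ideal_Rep_image entry_ideal_0 entry_ideal_add entry_ideal_minus
      entry_ideal_mult_left entry_ideal_mult_right)
  moreover have "x \<in> L' \<longleftrightarrow> x \<in> entry_ideal \<and> Rep_bop x \<in> skew_ops C" for x
    unfolding skew_ops_Rep by (subst L_eq) simp
  then have "L = Rep_bop ` entry_ideal \<inter> skew_ops C"
    unfolding L_image by blast
  ultimately show ?thesis by blast
qed

end

theorem theorem1p1:
  fixes C :: "'a::complex_hilbert_space \<Rightarrow> 'a"
    and L :: "('a \<Rightarrow>\<^sub>L 'a) set"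
  assumes "separable_space (euclidean :: 'a topology)"
    and "infinite_dimensional TYPE('a)"
    and "conjugation C"
    and "L \<subseteq> skew_ops C"
  shows "lie_ideal L (skew_ops C) \<longleftrightarrow>
    (\<exists>I. ideal I (bounded_ops_ring :: ('a \<Rightarrow>\<^sub>L 'a) ring) \<and> L = I \<inter> skew_ops C)"
proof -
  interpret conjugated_space C
    by standard fact
  show ?thesis
    using ideal_of_lie_ideal[OF assms(1,2)] lie_ideal_of_ideal by blast
qed

end
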